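(* Let $G$ be a finite group acting transitively on a finite set $X$ via $\sigma\colon G\to S_X$. Fix $x_0\in X$ with stabilizer $H\le G$, and select $\{t_x\}_{x\in X}\subseteq G$ with $\sigma(t_x)x_0=x$ for each $x$. Let $\mathbb{F}\in\{\mathbb{R},\mathbb{C}\}$ and let $\rho_i\colon G\to\operatorname{U}(\mathbb{F}^{d_i})$, $i\in[\ell]$, be pairwise inequivalent irreducible unitary representations. Suppose $\pi\colon H\to\operatorname{U}(\mathbb{F}^r)$ is a unitary representation (not necessarily irreducible) and $\Psi_i\in\mathbb{F}^{d_i\times r}$ are isometries with $\rho_i(h)\Psi_i=\Psi_i\pi(h)$ for all $i\in[\ell]$, $h\in H$. Put $d:=\sum_{i\in[\ell]}d_i$ and $\rho:=\bigoplus_{i\in[\ell]}\rho_i\colon G\to\operatorname{U}(\mathbb{F}^d)$. Then the vertical concatenation \[\begin{bmatrix}\sqrt{d_1/d}\,\Psi_1\\ \vdots\\ \sqrt{d_\ell/d}\,\Psi_\ell\end{bmatrix}\in\mathbb{F}^{d\times r}\] is an isometry onto a subspace $W\le\mathbb{F}^d$, and the ensemble $\mathcal{W}:=\{\rho(t_x)W\}_{x\in X}$ is a tight fusion frame for $\mathbb{F}^d$ whose automorphism group contains $\sigma(G)\le S_X$. Furthermore, if $G$ acts doubly homogeneously on $X$, then: (a) $\mathcal{W}$ is an equi-chordal tight fusion frame; and (b) when $|X|\ge2$, $\mathcal{W}$ is an equi-isoclinic tight fusion frame if and only if there exists $g\in G\setminus H$ such that $W$ and $\rho(g)W$ are iso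clinic.
   Context: For an ensemble $\{W_x\}_{x\in X}$ of $r$-dimensional subspaces of a finite-dimensional Hilbert space $V$ over $\mathbb{F}$, it is a tight fusion frame if the sum of the orthogonal projections onto the $W_x$ is a scalar multiple of the identity. For isometries $\Phi_x\colon\mathbb{F}^r\to V$ with image $W_x$, $W_x,W_y$ are $\alpha$-isoclinic if $(\Phi_x^*\Phi_y)^*(\Phi_x^*\Phi_y)=\alpha I$ ("isoclinic" means $\alpha$-isoclinic for some $\alpha$); the ensemble is equi-isoclinic if one $\alpha$ works for all pairs $x\ne y$. Chordal distance: $\operatorname{dist}_c(W_x,W_y)=\sqrt{r-\|\Phi_x^*\Phi_y\|_F^2}$. An equi-chordal tight fusion frame is a tight fusion frame with all pairwise chordal distances equal; an equi-isoclinic tight fusion frame is a tight fusion frame that is equi-isoclinic. The automorphism group of the ensemble is the set of $\tau\in S_X$ for which some unitary $U$ of $V$ satisfies $UW_x=W_{\tau(x)}$ for all $x$. $G$ acts doubly homogeneously on $X$ if for any two unordered pairs $\{x,y\},\{x',y'\}$ of distinct points there is $g\in G$ with $\{\sigma(g)x,\sigma(g)y\}=\{x',y'\}$. *)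

theory Defs
  imports
    "Jordan_Normal_Form.Schur_Decomposition"
    "HOL-Algebra.Group_Action"
begin

text \<open>
  The scalar field is the real or the complex numbers.  The class axioms say that \<open>to_complex\<close>
  is an isometric, conjugation-preserving isomorphism of real algebras onto \<open>\<real>\<close> or onto all of
  the complex numbers, so up to isomorphism \<open>real\<close> and \<open>complex\<close> are its only instances.
\<close>

class real_or_complex = conjugatable_ordered_field + real_normed_field +
  fixes to_complex :: "'a \<Rightarrow> complex"
  assumes to_complex_add: "to_complex (a + b) = to_complex a + to_complex b"
    and to_complex_mult: "to_complex (a * b) = to_complex a * to_complex b"
    and to_complex_scaleR: "to_complex (c *\<^sub>R a) = c *\<^sub>R to_complex a"
    and to_complex_conjugate: "to_complex (conjugate a) = cnj (to_complex a)"
    and norm_to_complex: "norm (to_complex a) = norm a"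
    and range_to_complex: "range to_complex = \<real> \<or> range to_complex = UNIV"

instantiation real :: real_or_complex
begin
definition "to_complex (a :: real) = complex_of_real a"
instance
  by intro_classes (auto simp: to_complex_real_def Reals_def scaleR_conv_of_real)
end

instantiation complex :: real_or_complex
begin
definition "to_complex (a :: complex) = a"
instance
  by intro_classes (auto simp: to_complex_complex_def)
end

lemma inj_to_complex: "inj (to_complex :: 'a::real_or_complex \<Rightarrow> complex)"
proof (rule injI)
  fix a b :: 'a
  assume eq: "to_complex a = to_complex b"
  have "to_complex a = to_complex (a - b) + to_complex b"
    by (simp flip: to_complex_add)
  with eq have "to_complex (a - b) = 0"
    by simp
  then show "a = b"
    using norm_to_complex[of "a - b"] by simp
qed

abbreviation is_subspace :: "nat \<Rightarrow> 'a::field vec set \<Rightarrow> bool" where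
  "is_subspace d W \<equiv> VectorSpace.subspace class_ring W (module_vec TYPE('a) d)"

definition subspace_dim :: "nat \<Rightarrow> 'a::field vec set \<Rightarrow> nat" where
  "subspace_dim d W = vectorspace.dim class_ring ((module_vec TYPE('a) d)\<lparr>carrier := W\<rparr>)"

definition mat_image :: "'a::semiring_0 mat \<Rightarrow> 'a vec set" where
  "mat_image A = (\<lambda>v. A *\<^sub>v v) ` carrier_vec (dim_col A)"

definition is_isometry :: "nat \<Rightarrow> nat \<Rightarrow> 'a::conjugatable_field mat \<Rightarrow> bool" where
  "is_isometry d r \<Phi> \<longleftrightarrow> \<Phi> \<in> carrier_mat d r \<and> mat_adjoint \<Phi> * \<Phi> = 1\<^sub>m r"

definition isometry_onto :: "nat \<Rightarrow> nat \<Rightarrow> 'a::conjugatable_field mat \<Rightarrow> 'a vec set \<Rightarrow> bool" where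
  "isometry_onto d r \<Phi> W \<longleftrightarrow> is_isometry d r \<Phi> \<and> mat_image \<Phi> = W"

definition orth_projection :: "nat \<Rightarrow> 'a::conjugatable_field mat \<Rightarrow> 'a vec set \<Rightarrow> bool" where
  "orth_projection d P W \<longleftrightarrow>
     P \<in> carrier_mat d d \<and> P * P = P \<and> mat_adjoint P = P \<and> mat_image P = W"

definition frobenius_norm :: "'a::real_normed_vector mat \<Rightarrow> real" where
  "frobenius_norm A = sqrt (\<Sum>i<dim_row A. \<Sum>j<dim_col A. (norm (A $$ (i, j)))\<^sup>2)"

definition stack_rows :: "nat \<Rightarrow> 'a::zero mat list \<Rightarrow> 'a mat" where
  "stack_rows r As = foldr (@\<^sub>r) As (0\<^sub>m 0 r)"

definition unitary_group :: "nat \<Rightarrow> 'a::conjugatable_field mat monoid" where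
  "unitary_group d =
     \<lparr>carrier = {U \<in> carrier_mat d d. mat_adjoint U * U = 1\<^sub>m d \<and> U * mat_adjoint U = 1\<^sub>m d},
      monoid.mult = (*), one = 1\<^sub>m d\<rparr>"

definition irreducible_rep :: "('g, 'b) monoid_scheme \<Rightarrow> nat \<Rightarrow> ('g \<Rightarrow> 'a::field mat) \<Rightarrow> bool" where
  "irreducible_rep G d \<rho> \<longleftrightarrow> d > 0 \<and>
     (\<forall>S. is_subspace d S \<and> (\<forall>g\<in>carrier G. \<forall>v\<in>S. \<rho> g *\<^sub>v v \<in> S)
        \<longrightarrow> S = {0\<^sub>v d} \<or> S = carrier_vec d)"

definition equivalent_reps ::
  "('g, 'b) monoid_scheme \<Rightarrow> nat \<Rightarrow> ('g \<Rightarrow> 'a::field mat) \<Rightarrow> nat \<Rightarrow> ('g \<Rightarrow> 'a mat) \<Rightarrow> bool" where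
  "equivalent_reps G d \<rho> d' \<rho>' \<longleftrightarrow>
     (\<exists>T \<in> carrier_mat d' d. invertible_mat T \<and> (\<forall>g\<in>carrier G. T * \<rho> g = \<rho>' g * T))"

definition doubly_homogeneous ::
  "('g, 'b) monoid_scheme \<Rightarrow> 'x set \<Rightarrow> ('g \<Rightarrow> 'x \<Rightarrow> 'x) \<Rightarrow> bool" where
  "doubly_homogeneous G X \<sigma> \<longleftrightarrow>
     (\<forall>x\<in>X. \<forall>y\<in>X. \<forall>x'\<in>X. \<forall>y'\<in>X. x \<noteq> y \<and> x' \<noteq> y' \<longrightarrow>
        (\<exists>g\<in>carrier G. {\<sigma> g x, \<sigma> g y} = {x', y'}))"

definition tight_fusion_frame ::
  "nat \<Rightarrow> nat \<Rightarrow> 'x set \<Rightarrow> ('x \<Rightarrow> 'a::real_or_complex vec set) \<Rightarrow> bool" where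
  "tight_fusion_frame d r X W \<longleftrightarrow>
     (\<forall>x\<in>X. is_subspace d (W x) \<and> subspace_dim d (W x) = r) \<and>
     (\<exists>P c. (\<forall>x\<in>X. orth_projection d (P x) (W x)) \<and>
        mat d d (\<lambda>(i, j). \<Sum>x\<in>X. P x $$ (i, j)) = c \<cdot>\<^sub>m 1\<^sub>m d)"

text \<open>
  The next two notions do not depend on the isometries: any two isometries onto the same subspace
  differ by a unitary factor on the right.
\<close>

definition alpha_isoclinic ::
  "nat \<Rightarrow> nat \<Rightarrow> 'a::real_or_complex \<Rightarrow> 'a vec set \<Rightarrow> 'a vec set \<Rightarrow> bool" where
  "alpha_isoclinic d r \<alpha> W W' \<longleftrightarrow>
     (\<exists>\<Phi> \<Phi>'. isometry_onto d r \<Phi> W \<and> isometry_onto d r \<Phi>' W' \<and>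
        mat_adjoint (mat_adjoint \<Phi> * \<Phi>') * (mat_adjoint \<Phi> * \<Phi>') = \<alpha> \<cdot>\<^sub>m 1\<^sub>m r)"

definition chordal_dist ::
  "nat \<Rightarrow> nat \<Rightarrow> 'a::real_or_complex vec set \<Rightarrow> 'a vec set \<Rightarrow> real" where
  "chordal_dist d r W W' =
     (let \<Phi> = (SOME \<Phi>. isometry_onto d r \<Phi> W); \<Phi>' = (SOME \<Phi>'. isometry_onto d r \<Phi>' W')
      in sqrt (real r - (frobenius_norm (mat_adjoint \<Phi> * \<Phi>'))\<^sup>2))"

definition isoclinic ::
  "nat \<Rightarrow> nat \<Rightarrow> 'a::real_or_complex vec set \<Rightarrow> 'a vec set \<Rightarrow> bool" where
  "isoclinic d r W W' \<longleftrightarrow> (\<exists>\<alpha>. alpha_isoclinic d r \<alpha> W W')"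

definition equi_isoclinic ::
  "nat \<Rightarrow> nat \<Rightarrow> 'x set \<Rightarrow> ('x \<Rightarrow> 'a::real_or_complex vec set) \<Rightarrow> bool" where
  "equi_isoclinic d r X W \<longleftrightarrow>
     (\<exists>\<alpha>. \<forall>x\<in>X. \<forall>y\<in>X. x \<noteq> y \<longrightarrow> alpha_isoclinic d r \<alpha> (W x) (W y))"

definition equi_chordal ::
  "nat \<Rightarrow> nat \<Rightarrow> 'x set \<Rightarrow> ('x \<Rightarrow> 'a::real_or_complex vec set) \<Rightarrow> bool" where
  "equi_chordal d r X W \<longleftrightarrow>
     (\<exists>\<delta>. \<forall>x\<in>X. \<forall>y\<in>X. x \<noteq> y \<longrightarrow> chordal_dist d r (W x) (W y) = \<delta>)"

definition equi_chordal_tff ::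
  "nat \<Rightarrow> nat \<Rightarrow> 'x set \<Rightarrow> ('x \<Rightarrow> 'a::real_or_complex vec set) \<Rightarrow> bool" where
  "equi_chordal_tff d r X W \<longleftrightarrow> tight_fusion_frame d r X W \<and> equi_chordal d r X W"

definition equi_isoclinic_tff ::
  "nat \<Rightarrow> nat \<Rightarrow> 'x set \<Rightarrow> ('x \<Rightarrow> 'a::real_or_complex vec set) \<Rightarrow> bool" where
  "equi_isoclinic_tff d r X W \<longleftrightarrow> tight_fusion_frame d r X W \<and> equi_isoclinic d r X W"

definition ensemble_automorphisms ::
  "nat \<Rightarrow> 'x set \<Rightarrow> ('x \<Rightarrow> 'a::conjugatable_field vec set) \<Rightarrow> ('x \<Rightarrow> 'x) set" where
  "ensemble_automorphisms d X W =
     {\<tau> \<in> carrier (BijGroup X).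
        \<exists>U \<in> carrier (unitary_group d). \<forall>x\<in>X. (\<lambda>v. U *\<^sub>v v) ` W x = W (\<tau> x)}"

end

theory Submission
  imports Defs "Jordan_Normal_Form.Matrix_Kernel" "Jordan_Normal_Form.Spectral_Radius"
begin

text \<open>
  The frame operator, i.e. the sum of the projections onto the subspaces \<open>\<rho>(t\<^sub>x)W\<close>, is self-adjoint
  and commutes with \<open>\<rho>\<close>.  Its blocks intertwine the irreducible constituents, so Schur's lemma kills
  the off-diagonal ones.  Over \<open>\<real>\<close> the commutant of an irreducible representation may be larger
  than the scalars, but a self-adjoint intertwiner has a real eigenvalue, and subtracting it leaves
  an intertwiner with a nonzero kernel; hence the diagonal blocks are scalar.  Comparing traces, the
  weights \<open>sqrt (d\<^sub>i / d)\<close> make all these scalars equal to \<open>|X| r / d\<close>.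

  The group permutes the subspaces by unitaries, and both the chordal distance and the isoclinic
  relation are symmetric and unitarily invariant; under double homogeneity a single pair of distinct
  points therefore determines all of them.
\<close>

section \<open>The scalar field\<close>

lemma conjugate_one [simp]: "conjugate (1 :: 'a::conjugatable_field) = 1"
proof -
  have "conjugate (1::'a) * conjugate 1 = conjugate 1"
    by (simp flip: conjugate_dist_mul)
  then show ?thesis by simp
qed

interpretation to_complex_hom: inj_comm_ring_hom "to_complex :: 'a::real_or_complex \<Rightarrow> complex"
proof
  show "to_complex (0::'a) = 0"
    using to_complex_add[of "0::'a" 0] by simp
  show inj: "x = 0" if "to_complex x = 0" for x :: 'a
    using that norm_to_complex[of x] by simp
  have "to_complex (1::'a) * to_complex (1::'a) = to_complex (1::'a)"
    by (simp only: mult_1_left flip: to_complex_mult)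
  then show "to_complex (1::'a) = 1"
    using inj[of 1] by auto
qed (simp_all add: to_complex_add to_complex_mult)

lemma to_complex_of_real [simp]: "to_complex (of_real c :: 'a::real_or_complex) = of_real c"
  by (simp add: of_real_def to_complex_scaleR)

lemma conjugate_mult_self: "conjugate a * a = (of_real ((norm a)\<^sup>2) :: 'a::real_or_complex)"
proof (rule injD[OF inj_to_complex])
  show "to_complex (conjugate a * a) = to_complex (of_real ((norm a)\<^sup>2) :: 'a)"
    using complex_norm_square[of "to_complex a"]
    unfolding to_complex_of_real to_complex_mult to_complex_conjugate norm_to_complex
    by (simp add: mult.commute)
qed

lemma norm_conjugate [simp]: "norm (conjugate a) = norm (a :: 'a::real_or_complex)"
  by (metis complex_mod_cnj norm_to_complex to_complex_conjugate)

section \<open>Adjoints, traces and Frobenius norms\<close>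

text \<open>
  The next two laws restate library facts with side conditions on dimensions in place of carrier
  premises, whose sizes the simplifier would have to guess.
\<close>

lemma assoc_mult_mat_dim:
  fixes A B C :: "'a::semiring_0 mat"
  shows "dim_col A = dim_row B \<Longrightarrow> dim_col B = dim_row C \<Longrightarrow> (A * B) * C = A * (B * C)"
  by (rule assoc_mult_mat[of A "dim_row A" "dim_row B" B "dim_row C" C "dim_col C"]) auto

lemma mult_smult_mat_dim:
  fixes A B :: "'a::comm_semiring_0 mat"
  assumes "dim_col A = dim_row B"
  shows "(c \<cdot>\<^sub>m A) * B = c \<cdot>\<^sub>m (A * B)" "A * (c \<cdot>\<^sub>m B) = c \<cdot>\<^sub>m (A * B)"
  using assms
  by (auto intro!: mult_smult_assoc_mat[of _ "dim_row A" "dim_row B" _ "dim_col B"]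
      mult_smult_distrib[of _ "dim_row A" "dim_row B" _ "dim_col B"])

lemma index_mult_mat_sum:
  "i < dim_row A \<Longrightarrow> j < dim_col B \<Longrightarrow> dim_col A = dim_row B \<Longrightarrow>
    (A * B) $$ (i, j) = (\<Sum>k<dim_row B. A $$ (i, k) * B $$ (k, j))"
  by (simp add: scalar_prod_def atLeast0LessThan)

lemma eq_mat_on_vecI:
  fixes A B :: "'a::semiring_1 mat"
  assumes A: "A \<in> carrier_mat m n" and B: "B \<in> carrier_mat m n"
    and eq: "\<And>v. v \<in> carrier_vec n \<Longrightarrow> A *\<^sub>v v = B *\<^sub>v v"
  shows "A = B"
proof (rule eq_matI)
  fix i j assume ij: "i < dim_row B" "j < dim_col B"
  have "(A *\<^sub>v unit_vec n j) $ i = (B *\<^sub>v unit_vec n j) $ i"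
    using eq by simp
  then show "A $$ (i, j) = B $$ (i, j)"
    using A B ij by (auto simp: row_def)
qed (use A B in auto)

lemma dim_mat_adjoint [simp]:
  "dim_row (mat_adjoint A) = dim_col A" "dim_col (mat_adjoint A) = dim_row A"
  by (auto simp: mat_adjoint_def)

lemma mat_adjoint_carrier [simp]: "A \<in> carrier_mat m n \<Longrightarrow> mat_adjoint A \<in> carrier_mat n m"
  by (rule carrier_matI) (simp_all add: carrier_matD)

lemma mult_adjoint_carrier: "A \<in> carrier_mat m n \<Longrightarrow> A * mat_adjoint A \<in> carrier_mat m m"
  using mult_carrier_mat[OF _ mat_adjoint_carrier] .

lemma index_mat_adjoint [simp]:
  "i < dim_col A \<Longrightarrow> j < dim_row A \<Longrightarrow> mat_adjoint A $$ (i, j) = conjugate (A $$ (j, i))"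
  by (simp add: mat_adjoint_def mat_of_rows_index)

lemma mat_adjoint_adjoint [simp]: "mat_adjoint (mat_adjoint A) = A"
  by (rule eq_matI) auto

lemma mat_adjoint_mult:
  "dim_col A = dim_row B \<Longrightarrow> mat_adjoint (A * B) = mat_adjoint B * mat_adjoint A"
  by (rule eq_matI)
    (auto simp: index_mult_mat_sum sum_conjugate conjugate_dist_mul mult.commute
      simp del: index_mult_mat(1))

lemma mat_adjoint_smult: "mat_adjoint (c \<cdot>\<^sub>m A) = conjugate c \<cdot>\<^sub>m mat_adjoint A"
  by (rule eq_matI) (auto simp: conjugate_dist_mul)

lemma cscalar_prod_mat_adjoint:
  assumes A: "A \<in> carrier_mat m n" and v: "v \<in> carrier_vec n" and w: "w \<in> carrier_vec m"
  shows "(A *\<^sub>v v) \<bullet>c w = v \<bullet>c (mat_adjoint A *\<^sub>v w)"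
proof -
  have "(A *\<^sub>v v) \<bullet>c w = (\<Sum>i<m. \<Sum>j<n. A $$ (i, j) * v $ j * conjugate (w $ i))"
    using assms by (simp add: scalar_prod_def atLeast0LessThan sum_distrib_right)
  also have "\<dots> = (\<Sum>j<n. \<Sum>i<m. v $ j * (A $$ (i, j) * conjugate (w $ i)))"
    by (subst sum.swap) (simp add: ac_simps)
  also have "\<dots> = v \<bullet>c (mat_adjoint A *\<^sub>v w)"
    using assms
    by (simp add: scalar_prod_def atLeast0LessThan sum_distrib_left sum_conjugate
        conjugate_dist_mul)
  finally show ?thesis .
qed

lemma adjoint_mult_self_eq_zero:
  fixes M :: "'a::conjugatable_ordered_field mat"
  assumes M: "M \<in> carrier_mat m n" and gram: "mat_adjoint M * M = 0\<^sub>m n n"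
  shows "M = 0\<^sub>m m n"
proof (rule eq_mat_on_vecI[OF M zero_carrier_mat])
  fix v :: "'a vec" assume v: "v \<in> carrier_vec n"
  have "mat_adjoint M *\<^sub>v (M *\<^sub>v v) = 0\<^sub>m n n *\<^sub>v v"
    unfolding gram[symmetric]
    by (rule assoc_mult_mat_vec[symmetric, OF mat_adjoint_carrier[OF M] M v])
  also have "\<dots> = 0\<^sub>v n"
    using v by auto
  finally have "mat_adjoint M *\<^sub>v (M *\<^sub>v v) = 0\<^sub>v n" .
  then have "(M *\<^sub>v v) \<bullet>c (M *\<^sub>v v) = 0"
    using cscalar_prod_mat_adjoint[OF M v, of "M *\<^sub>v v"] M v by simp
  then have "M *\<^sub>v v = 0\<^sub>v m"
    using conjugate_square_eq_0_vec[OF mult_mat_vec_carrier[OF M v]] by simp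
  then show "M *\<^sub>v v = 0\<^sub>m m n *\<^sub>v v"
    using v by auto
qed

definition mat_trace :: "'a::comm_monoid_add mat \<Rightarrow> 'a" where
  "mat_trace A = (\<Sum>i<dim_row A. A $$ (i, i))"

lemma mat_trace_comm:
  fixes A B :: "'a::comm_semiring_0 mat"
  assumes "dim_col A = dim_row B" "dim_col B = dim_row A"
  shows "mat_trace (A * B) = mat_trace (B * A)"
proof -
  have "mat_trace (A * B) = (\<Sum>i<dim_row A. \<Sum>k<dim_row B. A $$ (i, k) * B $$ (k, i))"
    using assms by (simp add: mat_trace_def index_mult_mat_sum del: index_mult_mat(1))
  also have "\<dots> = (\<Sum>k<dim_row B. \<Sum>i<dim_row A. B $$ (k, i) * A $$ (i, k))"
    by (subst sum.swap) (simp add: mult.commute)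
  also have "\<dots> = mat_trace (B * A)"
    using assms by (simp add: mat_trace_def index_mult_mat_sum del: index_mult_mat(1))
  finally show ?thesis .
qed

lemma mat_trace_smult_one [simp]:
  "mat_trace (c \<cdot>\<^sub>m 1\<^sub>m n) = c * (of_nat n :: 'a::comm_semiring_1)"
  by (simp add: mat_trace_def mult.commute)

lemma mat_trace_one [simp]: "mat_trace (1\<^sub>m n) = (of_nat n :: 'a::comm_semiring_1)"
  by (simp add: mat_trace_def)

lemma frobenius_norm_nonneg [simp]: "0 \<le> frobenius_norm M"
  by (simp add: frobenius_norm_def sum_nonneg)

lemma mat_trace_adjoint_mult_self:
  fixes M :: "'a::real_or_complex mat"
  shows "mat_trace (mat_adjoint M * M) = of_real ((frobenius_norm M)\<^sup>2)"
proof -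
  have "mat_trace (mat_adjoint M * M) =
      (\<Sum>j<dim_col M. \<Sum>i<dim_row M. of_real ((norm (M $$ (i, j)))\<^sup>2))"
    by (simp add: mat_trace_def index_mult_mat_sum conjugate_mult_self del: index_mult_mat(1))
  also have "\<dots> = (\<Sum>i<dim_row M. \<Sum>j<dim_col M. of_real ((norm (M $$ (i, j)))\<^sup>2))"
    by (rule sum.swap)
  also have "\<dots> = of_real ((frobenius_norm M)\<^sup>2)"
    by (simp add: frobenius_norm_def sum_nonneg)
  finally show ?thesis .
qed

lemma frobenius_norm_cong_gram:
  fixes M N :: "'a::real_or_complex mat"
  assumes "mat_adjoint M * M = mat_adjoint N * N"
  shows "frobenius_norm M = frobenius_norm N"
proof -
  have "of_real ((frobenius_norm M)\<^sup>2) = (of_real ((frobenius_norm N)\<^sup>2) :: 'a)"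
    by (simp only: assms flip: mat_trace_adjoint_mult_self)
  then show ?thesis
    by (simp only: of_real_eq_iff power2_eq_iff_nonneg frobenius_norm_nonneg)
qed

lemma frobenius_norm_adjoint:
  "frobenius_norm (mat_adjoint M) = frobenius_norm (M :: 'a::real_or_complex mat)"
  using sum.swap[of "\<lambda>i j. (norm (M $$ (i, j)))\<^sup>2" "{..<dim_col M}" "{..<dim_row M}"]
  by (simp add: frobenius_norm_def)

lemma frobenius_norm_smult:
  fixes M :: "'a::real_normed_div_algebra mat"
  shows "frobenius_norm (c \<cdot>\<^sub>m M) = norm c * frobenius_norm M"
  by (simp add: frobenius_norm_def norm_mult power_mult_distrib real_sqrt_mult
      flip: sum_distrib_left)

section \<open>Subspaces of coordinate space\<close>

lemma is_subspaceI:
  fixes W :: "'a::field vec set"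
  assumes "W \<subseteq> carrier_vec d" "0\<^sub>v d \<in> W"
    and "\<And>v w. v \<in> W \<Longrightarrow> w \<in> W \<Longrightarrow> v + w \<in> W" "\<And>c v. v \<in> W \<Longrightarrow> c \<cdot>\<^sub>v v \<in> W"
  shows "is_subspace d W"
  unfolding VectorSpace.subspace_def submodule_def
  using assms vec_vs vec_module by (auto simp: module_vec_simps class_ring_simps)

lemma mat_kernel_subspace:
  fixes A :: "'a::field mat"
  assumes A: "A \<in> carrier_mat m n"
  shows "is_subspace n (mat_kernel A)"
  using A
  by (intro is_subspaceI)
    (auto simp: mat_kernel[OF A] mult_add_distrib_mat_vec[OF A] mult_mat_vec[OF A])

lemma mat_image_eq: "A \<in> carrier_mat m n \<Longrightarrow> mat_image A = (*\<^sub>v) A ` carrier_vec n"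
  by (auto simp: mat_image_def)

lemma mat_image_subspace:
  fixes A :: "'a::field mat"
  assumes A: "A \<in> carrier_mat m n"
  shows "is_subspace m (mat_image A)"
proof (rule is_subspaceI)
  show "mat_image A \<subseteq> carrier_vec m"
    using A by (auto simp: mat_image_eq[OF A])
  show "0\<^sub>v m \<in> mat_image A"
    unfolding mat_image_eq[OF A] using A by (intro image_eqI[of _ _ "0\<^sub>v n"]) auto
  fix v assume "v \<in> mat_image A"
  then obtain a where a: "a \<in> carrier_vec n" "v = A *\<^sub>v a"
    by (auto simp: mat_image_eq[OF A])
  show "c \<cdot>\<^sub>v v \<in> mat_image A" for c
    unfolding mat_image_eq[OF A] using a mult_mat_vec[OF A a(1)]
    by (intro image_eqI[of _ _ "c \<cdot>\<^sub>v a"]) auto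
  fix w assume "w \<in> mat_image A"
  then obtain b where "b \<in> carrier_vec n" "w = A *\<^sub>v b"
    by (auto simp: mat_image_eq[OF A])
  then show "v + w \<in> mat_image A"
    unfolding mat_image_eq[OF A] using a mult_add_distrib_mat_vec[OF A a(1)]
    by (intro image_eqI[of _ _ "a + b"]) auto
qed

lemma mat_image_mult:
  fixes A B :: "'a::semiring_0 mat"
  assumes "A \<in> carrier_mat m n" "B \<in> carrier_mat n k"
  shows "mat_image (A * B) = (*\<^sub>v) A ` mat_image B"
  unfolding mat_image_eq[OF assms(2)] mat_image_eq[OF mult_carrier_mat[OF assms]] image_image
  by (rule image_cong[OF refl assoc_mult_mat_vec[OF assms]])

lemma mat_image_mult_subset:
  fixes A B :: "'a::semiring_0 mat"
  assumes "A \<in> carrier_mat m n" "B \<in> carrier_mat n k"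
  shows "mat_image (A * B) \<subseteq> mat_image A"
  unfolding mat_image_mult[OF assms] mat_image_eq[OF assms(1)] mat_image_eq[OF assms(2)]
  using assms(2) by auto

lemma subspace_dim_mat_image:
  fixes A :: "'a::field mat"
  assumes A: "A \<in> carrier_mat m n" and inj: "inj_on ((*\<^sub>v) A) (carrier_vec n)"
  shows "subspace_dim m (mat_image A) = n"
proof -
  interpret V: vec_space "TYPE('a)" n .
  let ?W = "(module_vec TYPE('a) m)\<lparr>carrier := mat_image A\<rparr>"
  have W: "vectorspace class_ring ?W"
    using vectorspace.subspace_is_vs[OF vec_vs mat_image_subspace[OF A]] by simp
  have "linear_map class_ring (module_vec TYPE('a) n) ?W ((*\<^sub>v) A)"
    unfolding linear_map_def mod_hom_def mod_hom_axioms_def LinearCombinations.module_hom_def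
    using W vec_vs[where 'a='a and n=n] A
    by (auto simp: vectorspace_def module_vec_simps class_ring_simps mat_image_def
        mult_add_distrib_mat_vec mult_mat_vec)
  from linear_map.dim_eq[OF this] have "V.dim = vectorspace.dim class_ring ?W"
    using inj V.fin_dim A by (auto simp: module_vec_simps mat_image_def)
  then show ?thesis
    by (simp add: subspace_dim_def V.dim_is_n)
qed

section \<open>Unitaries, isometries and orthogonal projections\<close>

lemma unitary_groupD:
  assumes "U \<in> carrier (unitary_group d)"
  shows "U \<in> carrier_mat d d" "dim_row U = d" "dim_col U = d"
    "mat_adjoint U * U = 1\<^sub>m d" "U * mat_adjoint U = 1\<^sub>m d"
  using assms by (auto simp: unitary_group_def)

lemma mat_image_unitary:
  assumes "U \<in> carrier (unitary_group d)"
  shows "mat_image U = carrier_vec d"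
proof
  note U = unitary_groupD[OF assms]
  show "mat_image U \<subseteq> carrier_vec d"
    using U(1) by (auto simp: mat_image_eq)
  have "carrier_vec d = mat_image (U * mat_adjoint U)"
    unfolding U(5) by (auto simp: mat_image_def)
  also have "\<dots> \<subseteq> mat_image U"
    using mat_image_mult_subset[OF U(1) mat_adjoint_carrier[OF U(1)]] .
  finally show "carrier_vec d \<subseteq> mat_image U" .
qed

lemma cross_gram_unitary_mult:
  assumes U: "U \<in> carrier (unitary_group m)"
    and A: "A \<in> carrier_mat m n" and B: "B \<in> carrier_mat m k"
  shows "mat_adjoint (U * A) * (U * B) = mat_adjoint A * B"
proof -
  note [simp] = carrier_matD[OF A] carrier_matD[OF B] unitary_groupD(2,3)[OF U]
  have "mat_adjoint (U * A) * (U * B) = mat_adjoint A * ((mat_adjoint U * U) * B)"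
    by (simp add: mat_adjoint_mult assoc_mult_mat_dim)
  then show ?thesis
    using B by (simp add: unitary_groupD(4)[OF U])
qed

lemma frobenius_norm_unitary_mult:
  fixes A :: "'a::real_or_complex mat"
  assumes "U \<in> carrier (unitary_group m)" "A \<in> carrier_mat m n"
  shows "frobenius_norm (U * A) = frobenius_norm A"
  using cross_gram_unitary_mult[OF assms assms(2)] by (rule frobenius_norm_cong_gram)

lemma is_isometryD:
  assumes "is_isometry d r \<Phi>"
  shows "\<Phi> \<in> carrier_mat d r" "dim_row \<Phi> = d" "dim_col \<Phi> = r" "mat_adjoint \<Phi> * \<Phi> = 1\<^sub>m r"
  using assms by (auto simp: is_isometry_def)

lemma frobenius_norm_isometry:
  fixes \<Phi> :: "'a::real_or_complex mat"
  assumes "is_isometry d r \<Phi>"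
  shows "(frobenius_norm \<Phi>)\<^sup>2 = real r"
proof -
  have "(of_real ((frobenius_norm \<Phi>)\<^sup>2) :: 'a) = of_real (real r)"
    using mat_trace_adjoint_mult_self[of \<Phi>] by (simp add: is_isometryD(4)[OF assms])
  then show ?thesis by (simp only: of_real_eq_iff)
qed

lemma isometry_ontoD:
  assumes "isometry_onto d r \<Phi> W"
  shows "is_isometry d r \<Phi>" "\<Phi> \<in> carrier_mat d r" "dim_row \<Phi> = d" "dim_col \<Phi> = r"
    "mat_adjoint \<Phi> * \<Phi> = 1\<^sub>m r" "mat_image \<Phi> = W"
  using assms by (auto simp: isometry_onto_def is_isometry_def)

lemma isometry_onto_subspace:
  assumes "isometry_onto d r \<Phi> W"
  shows "is_subspace d W" "subspace_dim d W = r"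
proof -
  note \<Phi> = isometry_ontoD[OF assms]
  show "is_subspace d W"
    using mat_image_subspace[OF \<Phi>(2)] by (simp add: \<Phi>(6))
  have "mat_adjoint \<Phi> *\<^sub>v (\<Phi> *\<^sub>v v) = v" if "v \<in> carrier_vec r" for v
    using assoc_mult_mat_vec[OF mat_adjoint_carrier[OF \<Phi>(2)] \<Phi>(2) that] that by (simp add: \<Phi>(5))
  then have "inj_on ((*\<^sub>v) \<Phi>) (carrier_vec r)"
    by (rule inj_on_inverseI)
  then show "subspace_dim d W = r"
    using subspace_dim_mat_image[OF \<Phi>(2)] by (simp add: \<Phi>(6))
qed

lemma isometry_onto_unitary_mult:
  assumes U: "U \<in> carrier (unitary_group d)" and \<Phi>: "isometry_onto d r \<Phi> W"
  shows "isometry_onto d r (U * \<Phi>) ((*\<^sub>v) U ` W)"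
  using cross_gram_unitary_mult[OF U isometry_ontoD(2,2)[OF \<Phi>]] isometry_ontoD[OF \<Phi>]
    mat_image_mult[OF unitary_groupD(1)[OF U] isometry_ontoD(2)[OF \<Phi>]] unitary_groupD(1)[OF U]
  by (simp add: isometry_onto_def is_isometry_def)

lemma orth_projection_isometry:
  assumes "isometry_onto d r \<Phi> W"
  shows "orth_projection d (\<Phi> * mat_adjoint \<Phi>) W"
proof -
  note \<Phi> = isometry_ontoD[OF assms]
  note [simp] = \<Phi>(3,4)
  let ?P = "\<Phi> * mat_adjoint \<Phi>"
  have P: "?P \<in> carrier_mat d d"
    using mult_adjoint_carrier[OF \<Phi>(2)] .
  have P_mult: "?P * \<Phi> = \<Phi>"
    using \<Phi>(2) by (simp add: assoc_mult_mat_dim \<Phi>(5))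
  have "?P * ?P = (?P * \<Phi>) * mat_adjoint \<Phi>"
    by (simp add: assoc_mult_mat_dim)
  then have idem: "?P * ?P = ?P" by (simp only: P_mult)
  have "mat_image ?P = mat_image \<Phi>"
  proof
    show "mat_image ?P \<subseteq> mat_image \<Phi>"
      using mat_image_mult_subset[OF \<Phi>(2) mat_adjoint_carrier[OF \<Phi>(2)]] .
    show "mat_image \<Phi> \<subseteq> mat_image ?P"
      using mat_image_mult_subset[OF P \<Phi>(2)] by (simp only: P_mult)
  qed
  then show ?thesis
    using P idem by (simp add: orth_projection_def mat_adjoint_mult \<Phi>(6))
qed

lemma idempotent_mult_eq:
  fixes P A :: "'a::semiring_1 mat"
  assumes P: "P \<in> carrier_mat m m" and idem: "P * P = P"
    and A: "A \<in> carrier_mat m n" and image: "mat_image A \<subseteq> mat_image P"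
  shows "P * A = A"
proof (rule eq_mat_on_vecI[OF mult_carrier_mat[OF P A] A])
  fix v :: "'a vec" assume v: "v \<in> carrier_vec n"
  then have "A *\<^sub>v v \<in> mat_image P"
    using image unfolding mat_image_eq[OF A] by blast
  then obtain u where u: "u \<in> carrier_vec m" "A *\<^sub>v v = P *\<^sub>v u"
    unfolding mat_image_eq[OF P] by blast
  have "(P * A) *\<^sub>v v = P *\<^sub>v (P *\<^sub>v u)"
    using assoc_mult_mat_vec[OF P A v] by (simp only: u(2))
  also have "\<dots> = (P * P) *\<^sub>v u"
    by (rule assoc_mult_mat_vec[symmetric, OF P P u(1)])
  finally show "(P * A) *\<^sub>v v = A *\<^sub>v v" by (simp only: idem u(2))
qed

lemma orth_projection_unique:
  assumes P: "orth_projection d P W" and Q: "orth_projection d Q W"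
  shows "P = Q"
proof -
  have absorb: "P * Q = Q" if "orth_projection d P W" "orth_projection d Q W" for P Q :: "'a mat"
    using that by (intro idempotent_mult_eq[of P d Q d]) (auto simp: orth_projection_def)
  have "P = mat_adjoint (Q * P)"
    unfolding absorb[OF Q P] using P by (simp add: orth_projection_def)
  also have "\<dots> = P * Q"
    using P Q unfolding orth_projection_def by (auto simp: mat_adjoint_mult)
  also have "\<dots> = Q"
    by (rule absorb[OF P Q])
  finally show ?thesis .
qed

section \<open>Eigenvalues of self-adjoint matrices\<close>

lemma self_adjoint_eigenvalue_conjugate:
  fixes A :: "'a::conjugatable_ordered_field mat"
  assumes A: "A \<in> carrier_mat d d" and adj: "mat_adjoint A = A" and k: "eigenvalue A k"
  shows "conjugate k = k"
proof -
  obtain v where v: "v \<in> carrier_vec d" "v \<noteq> 0\<^sub>v d" "A *\<^sub>v v = k \<cdot>\<^sub>v v"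
    using k A by (auto simp: eigenvalue_def eigenvector_def)
  have "(k \<cdot>\<^sub>v v) \<bullet>c v = v \<bullet>c (k \<cdot>\<^sub>v v)"
    using cscalar_prod_mat_adjoint[OF A v(1) v(1)] by (simp add: adj v(3))
  then have "k * (v \<bullet>c v) = conjugate k * (v \<bullet>c v)"
    using v(1) by (simp add: conjugate_smult_vec)
  moreover have "v \<bullet>c v \<noteq> 0"
    using v(1,2) by simp
  ultimately show ?thesis by simp
qed

text \<open>
  Over \<open>\<real>\<close> an eigenvalue exists because those of the complexified matrix are real.
\<close>

lemma self_adjoint_has_eigenvalue:
  fixes A :: "'a::real_or_complex mat"
  assumes A: "A \<in> carrier_mat d d" and adj: "mat_adjoint A = A" and d: "d > 0"
  shows "\<exists>c. eigenvalue A c"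
proof -
  define B where "B = map_mat to_complex A"
  have B: "B \<in> carrier_mat d d" using A by (simp add: B_def)
  have "mat_adjoint B = map_mat to_complex (mat_adjoint A)"
    by (rule eq_matI) (simp_all add: B_def to_complex_conjugate)
  then have adjB: "mat_adjoint B = B"
    by (simp add: adj B_def)
  obtain k where k: "eigenvalue B k"
    using spectrum_non_empty[OF B d] by (auto simp: spectrum_def)
  have "cnj k = k"
    using self_adjoint_eigenvalue_conjugate[OF B adjB k] by simp
  then have k_real: "k = to_complex (of_real (Re k) :: 'a)"
    by (simp add: complex_eq_iff)
  have "poly (map_poly to_complex (char_poly A)) (to_complex (of_real (Re k) :: 'a)) = 0"
    using k eigenvalue_root_char_poly[OF B, of k]
    by (simp only: B_def to_complex_hom.char_poly_hom[OF A] flip: k_real)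
  then have "to_complex (poly (char_poly A) (of_real (Re k))) = 0"
    by (simp only: to_complex_hom.poly_map_poly)
  then have "eigenvalue A (of_real (Re k))"
    unfolding eigenvalue_root_char_poly[OF A] by simp
  then show ?thesis ..
qed

section \<open>Intertwiners and Schur's lemma\<close>

definition intertwiner ::
  "('g, 'b) monoid_scheme \<Rightarrow> nat \<Rightarrow> ('g \<Rightarrow> 'a::semiring_0 mat) \<Rightarrow>
    nat \<Rightarrow> ('g \<Rightarrow> 'a mat) \<Rightarrow> 'a mat \<Rightarrow> bool" where
  "intertwiner G m \<rho> n \<rho>' T \<longleftrightarrow>
     T \<in> carrier_mat n m \<and>
     (\<forall>g\<in>carrier G. \<rho> g \<in> carrier_mat m m \<and> \<rho>' g \<in> carrier_mat n n \<and> T * \<rho> g = \<rho>' g * T)"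

lemma intertwinerI:
  assumes "T \<in> carrier_mat n m"
    and "\<And>g. g \<in> carrier G \<Longrightarrow> \<rho> g \<in> carrier_mat m m"
    and "\<And>g. g \<in> carrier G \<Longrightarrow> \<rho>' g \<in> carrier_mat n n"
    and "\<And>g. g \<in> carrier G \<Longrightarrow> T * \<rho> g = \<rho>' g * T"
  shows "intertwiner G m \<rho> n \<rho>' T"
  using assms by (simp add: intertwiner_def)

lemma intertwinerD:
  assumes "intertwiner G m \<rho> n \<rho>' T"
  shows "T \<in> carrier_mat n m" "dim_row T = n" "dim_col T = m"
    and "g \<in> carrier G \<Longrightarrow> \<rho> g \<in> carrier_mat m m"
    and "g \<in> carrier G \<Longrightarrow> \<rho>' g \<in> carrier_mat n n"
    and "g \<in> carrier G \<Longrightarrow> T * \<rho> g = \<rho>' g * T"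
  using assms by (auto simp: intertwiner_def)

lemma intertwiner_mult:
  assumes S: "intertwiner G m \<rho> n \<rho>' S" and T: "intertwiner G n \<rho>' k \<rho>'' T"
  shows "intertwiner G m \<rho> k \<rho>'' (T * S)"
proof (rule intertwinerI)
  note S = intertwinerD[OF S] and T = intertwinerD[OF T]
  show "T * S \<in> carrier_mat k m" using S(1) T(1) by simp
  fix g assume g: "g \<in> carrier G"
  show "\<rho> g \<in> carrier_mat m m" "\<rho>'' g \<in> carrier_mat k k"
    using S(4)[OF g] T(5)[OF g] .
  note [simp] = S(2,3) T(2,3) carrier_matD[OF S(4)[OF g]] carrier_matD[OF S(5)[OF g]]
    carrier_matD[OF T(5)[OF g]]
  have "T * S * \<rho> g = (T * \<rho>' g) * S"
    by (simp add: assoc_mult_mat_dim S(6)[OF g])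
  also have "\<dots> = \<rho>'' g * (T * S)"
    by (simp add: assoc_mult_mat_dim T(6)[OF g])
  finally show "T * S * \<rho> g = \<rho>'' g * (T * S)" .
qed

lemma intertwiner_smult:
  fixes T :: "'a::comm_semiring_0 mat"
  assumes T: "intertwiner G m \<rho> n \<rho>' T"
  shows "intertwiner G m \<rho> n \<rho>' (c \<cdot>\<^sub>m T)"
proof (rule intertwinerI)
  note T = intertwinerD[OF T]
  show "c \<cdot>\<^sub>m T \<in> carrier_mat n m" using T(1) by simp
  fix g assume g: "g \<in> carrier G"
  show "\<rho> g \<in> carrier_mat m m" "\<rho>' g \<in> carrier_mat n n"
    using T(4)[OF g] T(5)[OF g] .
  show "c \<cdot>\<^sub>m T * \<rho> g = \<rho>' g * (c \<cdot>\<^sub>m T)"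
    using mult_smult_assoc_mat[OF T(1) T(4)[OF g]] mult_smult_distrib[OF T(5)[OF g] T(1)]
    by (simp add: T(6)[OF g])
qed

lemma intertwiner_char_matrix:
  fixes A :: "'a::field mat"
  assumes A: "intertwiner G d \<rho> d \<rho> A"
  shows "intertwiner G d \<rho> d \<rho> (char_matrix A c)"
proof (rule intertwinerI)
  note A = intertwinerD[OF A]
  show "char_matrix A c \<in> carrier_mat d d" using A(1) by simp
  fix g assume g: "g \<in> carrier G"
  show \<rho>: "\<rho> g \<in> carrier_mat d d" "\<rho> g \<in> carrier_mat d d"
    using A(4)[OF g] by simp_all
  show "char_matrix A c * \<rho> g = \<rho> g * char_matrix A c"
    using A(1) \<rho> A(6)[OF g]
    by (simp add: char_matrix_def add_mult_distrib_mat[of _ d d] mult_add_distrib_mat[of _ d d]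
        mult_smult_mat_dim)
qed

lemma unitary_rep_carrier:
  "\<rho> \<in> hom G (unitary_group d) \<Longrightarrow> g \<in> carrier G \<Longrightarrow> \<rho> g \<in> carrier (unitary_group d)"
  by (auto simp: hom_def)

lemma unitary_rep_carrier_mat:
  "\<rho> \<in> hom G (unitary_group d) \<Longrightarrow> g \<in> carrier G \<Longrightarrow> \<rho> g \<in> carrier_mat d d"
  by (rule unitary_groupD(1)[OF unitary_rep_carrier])

lemma intertwiner_adjoint:
  assumes \<rho>: "\<rho> \<in> hom G (unitary_group m)" and \<rho>': "\<rho>' \<in> hom G (unitary_group n)"
    and T: "intertwiner G m \<rho> n \<rho>' T"
  shows "intertwiner G n \<rho>' m \<rho> (mat_adjoint T)"
proof (rule intertwinerI)
  note T = intertwinerD[OF T]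
  show "mat_adjoint T \<in> carrier_mat m n" using T(1) by simp
  fix g assume g: "g \<in> carrier G"
  note U = unitary_groupD[OF unitary_rep_carrier[OF \<rho> g]]
    and U' = unitary_groupD[OF unitary_rep_carrier[OF \<rho>' g]]
  note [simp] = U(2,3) U'(2,3) T(2,3)
  show "\<rho> g \<in> carrier_mat m m" "\<rho>' g \<in> carrier_mat n n" using U(1) U'(1) .
  have "mat_adjoint T * \<rho>' g = (\<rho> g * mat_adjoint (\<rho> g)) * mat_adjoint T * \<rho>' g"
    using T(1) by (simp add: U(5) left_mult_one_mat[OF mat_adjoint_carrier])
  also have "\<dots> = \<rho> g * (mat_adjoint (T * \<rho> g) * \<rho>' g)"
    by (simp add: assoc_mult_mat_dim mat_adjoint_mult)
  also have "\<dots> = \<rho> g * (mat_adjoint T * (mat_adjoint (\<rho>' g) * \<rho>' g))"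
    by (simp add: assoc_mult_mat_dim mat_adjoint_mult T(6)[OF g])
  also have "\<dots> = \<rho> g * mat_adjoint T"
    using T(1) by (simp add: U'(4) right_mult_one_mat[OF mat_adjoint_carrier])
  finally show "mat_adjoint T * \<rho>' g = \<rho> g * mat_adjoint T" .
qed

lemma irreducible_rep_dim_pos: "irreducible_rep G d \<rho> \<Longrightarrow> d > 0"
  by (simp add: irreducible_rep_def)

lemma irreducible_intertwiner_kernel:
  fixes T :: "'a::field mat"
  assumes irr: "irreducible_rep G m \<rho>" and T: "intertwiner G m \<rho> n \<rho>' T"
    and v: "v \<in> carrier_vec m" "v \<noteq> 0\<^sub>v m" "T *\<^sub>v v = 0\<^sub>v n"
  shows "T = 0\<^sub>m n m"
proof -
  note T = intertwinerD[OF T]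
  have "\<rho> g *\<^sub>v w \<in> mat_kernel T" if g: "g \<in> carrier G" and w: "w \<in> mat_kernel T" for g w
  proof (rule mat_kernelI[OF T(1)])
    note w = mat_kernelD[OF T(1) w]
    show "\<rho> g *\<^sub>v w \<in> carrier_vec m"
      using mult_mat_vec_carrier[OF T(4)[OF g] w(1)] .
    have "T *\<^sub>v (\<rho> g *\<^sub>v w) = (T * \<rho> g) *\<^sub>v w"
      by (rule assoc_mult_mat_vec[symmetric, OF T(1) T(4)[OF g] w(1)])
    also have "\<dots> = \<rho>' g *\<^sub>v (T *\<^sub>v w)"
      unfolding T(6)[OF g] by (rule assoc_mult_mat_vec[OF T(5)[OF g] T(1) w(1)])
    also have "\<dots> = 0\<^sub>v n"
      using T(5)[OF g] by (auto simp: w(2))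
    finally show "T *\<^sub>v (\<rho> g *\<^sub>v w) = 0\<^sub>v n" .
  qed
  then have "mat_kernel T = {0\<^sub>v m} \<or> mat_kernel T = carrier_vec m"
    using irr mat_kernel_subspace[OF T(1)] unfolding irreducible_rep_def by blast
  moreover have "v \<in> mat_kernel T"
    using mat_kernelI[OF T(1) v(1,3)] .
  ultimately have "mat_kernel T = carrier_vec m"
    using v(2) by blast
  then have "T *\<^sub>v w = 0\<^sub>m n m *\<^sub>v w" if "w \<in> carrier_vec m" for w
    using mat_kernelD(2)[OF T(1)] that by auto
  then show ?thesis
    by (intro eq_mat_on_vecI[OF T(1) zero_carrier_mat])
qed

lemma self_adjoint_intertwiner_scalar:
  fixes A :: "'a::real_or_complex mat"
  assumes irr: "irreducible_rep G d \<rho>" and A: "intertwiner G d \<rho> d \<rho> A"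
    and adj: "mat_adjoint A = A"
  obtains c where "A = c \<cdot>\<^sub>m 1\<^sub>m d"
proof -
  note A' = intertwinerD(1)[OF A]
  obtain c where "eigenvalue A c"
    using self_adjoint_has_eigenvalue[OF A' adj irreducible_rep_dim_pos[OF irr]] by blast
  then obtain v where "v \<in> carrier_vec d" "v \<noteq> 0\<^sub>v d" "char_matrix A c *\<^sub>v v = 0\<^sub>v d"
    unfolding eigenvalue_char_matrix[OF A'] by blast
  then have zero: "char_matrix A c = 0\<^sub>m d d"
    by (rule irreducible_intertwiner_kernel[OF irr intertwiner_char_matrix[OF A]])
  have "A = c \<cdot>\<^sub>m 1\<^sub>m d"
  proof (rule eq_matI)
    fix i j assume "i < dim_row (c \<cdot>\<^sub>m 1\<^sub>m d)" "j < dim_col (c \<cdot>\<^sub>m 1\<^sub>m d)"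
    then show "A $$ (i, j) = (c \<cdot>\<^sub>m 1\<^sub>m d) $$ (i, j)"
      using arg_cong[OF zero, of "\<lambda>M. M $$ (i, j)"] A' by (auto simp: char_matrix_def)
  qed (use A' in auto)
  then show thesis by (rule that)
qed

lemma scalar_gram_left_inverse:
  fixes T :: "'a::conjugatable_ordered_field mat"
  assumes T: "T \<in> carrier_mat n m" "T \<noteq> 0\<^sub>m n m" and gram: "mat_adjoint T * T = a \<cdot>\<^sub>m 1\<^sub>m m"
  shows "a \<noteq> 0" "(inverse a \<cdot>\<^sub>m mat_adjoint T) * T = 1\<^sub>m m"
proof -
  show "a \<noteq> 0"
  proof
    assume "a = 0"
    then have "mat_adjoint T * T = 0\<^sub>m m m" unfolding gram by (intro eq_matI) auto
    then show False using adjoint_mult_self_eq_zero[OF T(1)] T(2) by blast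
  qed
  then show "(inverse a \<cdot>\<^sub>m mat_adjoint T) * T = 1\<^sub>m m"
    using T(1) gram by (auto simp: mult_smult_mat_dim intro!: eq_matI)
qed

lemma invertible_if_scalar_grams:
  fixes T :: "'a::real_or_complex mat"
  assumes T: "T \<in> carrier_mat n m" "T \<noteq> 0\<^sub>m n m"
    and gram: "mat_adjoint T * T = a \<cdot>\<^sub>m 1\<^sub>m m" and cogram: "T * mat_adjoint T = b \<cdot>\<^sub>m 1\<^sub>m n"
  shows "invertible_mat T"
proof -
  note [simp] = carrier_matD[OF T(1)]
  let ?L = "inverse a \<cdot>\<^sub>m mat_adjoint T" and ?R = "inverse b \<cdot>\<^sub>m mat_adjoint T"
  have L: "?L * T = 1\<^sub>m m"
    by (rule scalar_gram_left_inverse(2)[OF T gram])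
  have "mat_adjoint T \<noteq> 0\<^sub>m m n"
  proof
    assume "mat_adjoint T = 0\<^sub>m m n"
    then have "mat_adjoint T * T = 0\<^sub>m m m" by simp
    then show False using adjoint_mult_self_eq_zero[OF T(1)] T(2) by blast
  qed
  then have "b \<noteq> 0"
    using T(1) cogram scalar_gram_left_inverse(1)[of "mat_adjoint T" m n b] by simp
  then have R: "T * ?R = 1\<^sub>m n"
    by (auto simp: mult_smult_mat_dim cogram intro!: eq_matI)
  have "?L = ?L * (T * ?R)" unfolding R by simp
  also have "\<dots> = (?L * T) * ?R" by (simp add: assoc_mult_mat_dim)
  also have "\<dots> = ?R" unfolding L by simp
  finally have L': "T * ?L = 1\<^sub>m n" using R by simp
  have "(of_nat m :: 'a) = of_nat n"
    using mat_trace_comm[of ?L T] by (simp add: L L')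
  then have "m = n" by simp
  then show ?thesis
    unfolding invertible_mat_def inverts_mat_def using L L' by (auto intro!: exI[of _ ?L])
qed

lemma inequivalent_intertwiner_zero:
  fixes T :: "'a::real_or_complex mat"
  assumes \<rho>: "\<rho> \<in> hom G (unitary_group m)" "irreducible_rep G m \<rho>"
    and \<rho>': "\<rho>' \<in> hom G (unitary_group n)" "irreducible_rep G n \<rho>'"
    and inequiv: "\<not> equivalent_reps G m \<rho> n \<rho>'" and T: "intertwiner G m \<rho> n \<rho>' T"
  shows "T = 0\<^sub>m n m"
proof (rule ccontr)
  assume "T \<noteq> 0\<^sub>m n m"
  note T' = intertwiner_adjoint[OF \<rho>(1) \<rho>'(1) T]
  note [simp] = intertwinerD(2,3)[OF T]
  obtain a where a: "mat_adjoint T * T = a \<cdot>\<^sub>m 1\<^sub>m m"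
    by (rule self_adjoint_intertwiner_scalar[OF \<rho>(2) intertwiner_mult[OF T T']])
      (simp_all add: mat_adjoint_mult)
  obtain b where b: "T * mat_adjoint T = b \<cdot>\<^sub>m 1\<^sub>m n"
    by (rule self_adjoint_intertwiner_scalar[OF \<rho>'(2) intertwiner_mult[OF T' T]])
      (simp_all add: mat_adjoint_mult)
  have "invertible_mat T"
    by (rule invertible_if_scalar_grams[OF intertwinerD(1)[OF T] \<open>T \<noteq> 0\<^sub>m n m\<close> a b])
  then have "equivalent_reps G m \<rho> n \<rho>'"
    using intertwinerD(1,6)[OF T] unfolding equivalent_reps_def by blast
  with inequiv show False ..
qed

lemma mat_image_intertwiner_invariant:
  assumes \<pi>: "\<pi> \<in> hom K (unitary_group r)" and \<Psi>: "intertwiner K r \<pi> d \<rho> \<Psi>"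
    and h: "h \<in> carrier K"
  shows "(*\<^sub>v) (\<rho> h) ` mat_image \<Psi> = mat_image \<Psi>"
proof -
  note \<Psi> = intertwinerD[OF \<Psi>]
  have "(*\<^sub>v) (\<rho> h) ` mat_image \<Psi> = mat_image (\<Psi> * \<pi> h)"
    unfolding \<Psi>(6)[OF h] by (rule mat_image_mult[symmetric, OF \<Psi>(5)[OF h] \<Psi>(1)])
  also have "\<dots> = (*\<^sub>v) \<Psi> ` mat_image (\<pi> h)"
    by (rule mat_image_mult[OF \<Psi>(1) \<Psi>(4)[OF h]])
  also have "\<dots> = mat_image \<Psi>"
    by (simp add: mat_image_unitary[OF unitary_rep_carrier[OF \<pi> h]] mat_image_eq[OF \<Psi>(1)])
  finally show ?thesis .
qed

section \<open>Pairs of subspaces\<close>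

lemma frobenius_norm_cross_gram:
  fixes A B :: "'a::real_or_complex mat"
  assumes "dim_row A = dim_row B"
  shows "of_real ((frobenius_norm (mat_adjoint A * B))\<^sup>2) =
    mat_trace ((A * mat_adjoint A) * (B * mat_adjoint B))"
proof -
  have "of_real ((frobenius_norm (mat_adjoint A * B))\<^sup>2) =
      mat_trace (mat_adjoint B * (A * mat_adjoint A * B))"
    unfolding mat_trace_adjoint_mult_self[symmetric]
    using assms by (simp add: mat_adjoint_mult assoc_mult_mat_dim)
  also have "\<dots> = mat_trace ((A * mat_adjoint A * B) * mat_adjoint B)"
    using assms by (intro mat_trace_comm) auto
  finally show ?thesis
    using assms by (simp add: assoc_mult_mat_dim)
qed

lemma chordal_dist_isometry:
  fixes \<Phi> \<Phi>' :: "'a::real_or_complex mat"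
  assumes \<Phi>: "isometry_onto d r \<Phi> W" and \<Phi>': "isometry_onto d r \<Phi>' W'"
  shows "chordal_dist d r W W' = sqrt (real r - (frobenius_norm (mat_adjoint \<Phi> * \<Phi>'))\<^sup>2)"
proof -
  define \<Theta> where "\<Theta> = (SOME \<Phi>. isometry_onto d r \<Phi> W)"
  define \<Theta>' where "\<Theta>' = (SOME \<Phi>. isometry_onto d r \<Phi> W')"
  have \<Theta>: "isometry_onto d r \<Theta> W" and \<Theta>': "isometry_onto d r \<Theta>' W'"
    using \<Phi> \<Phi>' unfolding \<Theta>_def \<Theta>'_def by (metis someI)+
  have "\<Theta> * mat_adjoint \<Theta> = \<Phi> * mat_adjoint \<Phi>" "\<Theta>' * mat_adjoint \<Theta>' = \<Phi>' * mat_adjoint \<Phi>'"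
    using orth_projection_isometry orth_projection_unique \<Phi> \<Phi>' \<Theta> \<Theta>' by blast+
  then have "of_real ((frobenius_norm (mat_adjoint \<Theta> * \<Theta>'))\<^sup>2) =
      (of_real ((frobenius_norm (mat_adjoint \<Phi> * \<Phi>'))\<^sup>2) :: 'a)"
    by (simp only: frobenius_norm_cross_gram isometry_ontoD(3)[OF \<Phi>] isometry_ontoD(3)[OF \<Phi>']
        isometry_ontoD(3)[OF \<Theta>] isometry_ontoD(3)[OF \<Theta>'])
  then have "(frobenius_norm (mat_adjoint \<Theta> * \<Theta>'))\<^sup>2 = (frobenius_norm (mat_adjoint \<Phi> * \<Phi>'))\<^sup>2"
    by (simp only: of_real_eq_iff)
  then show ?thesis by (simp add: chordal_dist_def \<Theta>_def \<Theta>'_def)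
qed

lemma chordal_dist_commute:
  fixes \<Phi> \<Phi>' :: "'a::real_or_complex mat"
  assumes \<Phi>: "isometry_onto d r \<Phi> W" and \<Phi>': "isometry_onto d r \<Phi>' W'"
  shows "chordal_dist d r W W' = chordal_dist d r W' W"
proof -
  have "mat_adjoint \<Phi>' * \<Phi> = mat_adjoint (mat_adjoint \<Phi> * \<Phi>')"
    using isometry_ontoD(3)[OF \<Phi>] isometry_ontoD(3)[OF \<Phi>'] by (simp add: mat_adjoint_mult)
  then show ?thesis
    by (simp add: chordal_dist_isometry[OF \<Phi> \<Phi>'] chordal_dist_isometry[OF \<Phi>' \<Phi>]
        frobenius_norm_adjoint)
qed

lemma chordal_dist_unitary:
  fixes \<Phi> \<Phi>' :: "'a::real_or_complex mat"
  assumes U: "U \<in> carrier (unitary_group d)"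
    and \<Phi>: "isometry_onto d r \<Phi> W" and \<Phi>': "isometry_onto d r \<Phi>' W'"
  shows "chordal_dist d r ((*\<^sub>v) U ` W) ((*\<^sub>v) U ` W') = chordal_dist d r W W'"
  using chordal_dist_isometry[OF isometry_onto_unitary_mult[OF U \<Phi>]
      isometry_onto_unitary_mult[OF U \<Phi>']]
    chordal_dist_isometry[OF \<Phi> \<Phi>']
    cross_gram_unitary_mult[OF U isometry_ontoD(2)[OF \<Phi>] isometry_ontoD(2)[OF \<Phi>']]
  by simp

lemma alpha_isoclinic_unitary:
  assumes U: "U \<in> carrier (unitary_group d)" and "alpha_isoclinic d r \<alpha> W W'"
  shows "alpha_isoclinic d r \<alpha> ((*\<^sub>v) U ` W) ((*\<^sub>v) U ` W')"
proof -
  obtain \<Phi> \<Phi>' where \<Phi>: "isometry_onto d r \<Phi> W" and \<Phi>': "isometry_onto d r \<Phi>' W'"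
    and gram: "mat_adjoint (mat_adjoint \<Phi> * \<Phi>') * (mat_adjoint \<Phi> * \<Phi>') = \<alpha> \<cdot>\<^sub>m 1\<^sub>m r"
    using assms by (auto simp: alpha_isoclinic_def)
  have "mat_adjoint (U * \<Phi>) * (U * \<Phi>') = mat_adjoint \<Phi> * \<Phi>'"
    by (rule cross_gram_unitary_mult[OF U isometry_ontoD(2)[OF \<Phi>] isometry_ontoD(2)[OF \<Phi>']])
  with gram show ?thesis
    unfolding alpha_isoclinic_def
    using isometry_onto_unitary_mult[OF U \<Phi>] isometry_onto_unitary_mult[OF U \<Phi>'] by metis
qed

lemma scalar_gram_commute:
  fixes M :: "'a::conjugatable_ordered_field mat"
  assumes M: "M \<in> carrier_mat r r" and gram: "mat_adjoint M * M = \<alpha> \<cdot>\<^sub>m 1\<^sub>m r"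
  shows "M * mat_adjoint M = \<alpha> \<cdot>\<^sub>m 1\<^sub>m r"
proof (cases "M = 0\<^sub>m r r")
  case True
  have "\<alpha> \<cdot>\<^sub>m 1\<^sub>m r = (0\<^sub>m r r :: 'a mat)"
    unfolding gram[symmetric] by (simp add: True)
  then show ?thesis by (simp add: True)
next
  case False
  note left_inverse = scalar_gram_left_inverse[OF M False gram]
  note [simp] = carrier_matD[OF M]
  have "M * (inverse \<alpha> \<cdot>\<^sub>m mat_adjoint M) = 1\<^sub>m r"
    by (rule mat_mult_left_right_inverse[OF smult_carrier_mat[OF mat_adjoint_carrier[OF M]] M
          left_inverse(2)])
  then have "inverse \<alpha> \<cdot>\<^sub>m (M * mat_adjoint M) = 1\<^sub>m r"
    by (simp add: mult_smult_mat_dim)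
  then have "\<alpha> \<cdot>\<^sub>m (inverse \<alpha> \<cdot>\<^sub>m (M * mat_adjoint M)) = \<alpha> \<cdot>\<^sub>m 1\<^sub>m r"
    by simp
  moreover have "\<alpha> \<cdot>\<^sub>m (inverse \<alpha> \<cdot>\<^sub>m (M * mat_adjoint M)) = M * mat_adjoint M"
    using left_inverse(1) by (intro eq_matI) (auto simp del: index_mult_mat(1))
  ultimately show ?thesis by simp
qed

lemma alpha_isoclinic_commute:
  assumes "alpha_isoclinic d r \<alpha> W W'"
  shows "alpha_isoclinic d r \<alpha> W' W"
proof -
  obtain \<Phi> \<Phi>' where \<Phi>: "isometry_onto d r \<Phi> W" and \<Phi>': "isometry_onto d r \<Phi>' W'"
    and gram: "mat_adjoint (mat_adjoint \<Phi> * \<Phi>') * (mat_adjoint \<Phi> * \<Phi>') = \<alpha> \<cdot>\<^sub>m 1\<^sub>m r"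
    using assms by (auto simp: alpha_isoclinic_def)
  let ?M = "mat_adjoint \<Phi> * \<Phi>'"
  have M: "?M \<in> carrier_mat r r"
    using isometry_ontoD(2)[OF \<Phi>'] isometry_ontoD(2)[OF \<Phi>]
    by (intro mult_carrier_mat mat_adjoint_carrier)
  have M_adjoint: "mat_adjoint \<Phi>' * \<Phi> = mat_adjoint ?M"
    using isometry_ontoD(3)[OF \<Phi>] isometry_ontoD(3)[OF \<Phi>'] by (simp add: mat_adjoint_mult)
  have "mat_adjoint (mat_adjoint \<Phi>' * \<Phi>) * (mat_adjoint \<Phi>' * \<Phi>) = \<alpha> \<cdot>\<^sub>m 1\<^sub>m r"
    unfolding M_adjoint mat_adjoint_adjoint by (rule scalar_gram_commute[OF M gram])
  then show ?thesis
    unfolding alpha_isoclinic_def using \<Phi> \<Phi>' by blast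
qed

section \<open>Sums of families of matrices\<close>

definition family_sum :: "nat \<Rightarrow> nat \<Rightarrow> 'x set \<Rightarrow> ('x \<Rightarrow> 'a::comm_monoid_add mat) \<Rightarrow> 'a mat" where
  "family_sum m n X P = mat m n (\<lambda>(i, j). \<Sum>x\<in>X. P x $$ (i, j))"

lemma family_sum_carrier [simp]: "family_sum m n X P \<in> carrier_mat m n"
  and dim_family_sum [simp]: "dim_row (family_sum m n X P) = m" "dim_col (family_sum m n X P) = n"
  by (auto simp: family_sum_def)

lemma index_family_sum [simp]:
  "i < m \<Longrightarrow> j < n \<Longrightarrow> family_sum m n X P $$ (i, j) = (\<Sum>x\<in>X. P x $$ (i, j))"
  by (simp add: family_sum_def)

lemma family_sum_cong:
  assumes "\<And>x. x \<in> X \<Longrightarrow> P x = Q x"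
  shows "family_sum m n X P = family_sum m n X Q"
  using assms by (intro eq_matI) auto

lemma family_sum_reindex:
  assumes "bij_betw s X X"
  shows "family_sum m n X (\<lambda>x. P (s x)) = family_sum m n X P"
  unfolding family_sum_def using sum.reindex_bij_betw[OF assms, of "\<lambda>x. P x $$ _"] by simp

lemma family_sum_single:
  assumes "finite X" "y \<in> X" "P y \<in> carrier_mat m n" "\<And>x. x \<in> X \<Longrightarrow> x \<noteq> y \<Longrightarrow> P x = 0\<^sub>m m n"
  shows "family_sum m n X P = P y"
proof (rule eq_matI)
  fix i j assume "i < dim_row (P y)" "j < dim_col (P y)"
  then have ij: "i < m" "j < n" using assms(3) by auto
  have "(\<Sum>x\<in>X. P x $$ (i, j)) = (\<Sum>x\<in>{y}. P x $$ (i, j))"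
    using assms ij by (intro sum.mono_neutral_right) auto
  then show "family_sum m n X P $$ (i, j) = P y $$ (i, j)"
    using ij by simp
qed (use assms(3) in auto)

lemma mult_family_sum:
  fixes A :: "'a::semiring_0 mat"
  assumes A: "A \<in> carrier_mat k m" and P: "\<And>x. x \<in> X \<Longrightarrow> P x \<in> carrier_mat m n"
  shows "A * family_sum m n X P = family_sum k n X (\<lambda>x. A * P x)"
proof (rule eq_matI)
  fix i j
  assume "i < dim_row (family_sum k n X (\<lambda>x. A * P x))"
    and "j < dim_col (family_sum k n X (\<lambda>x. A * P x))"
  then have ij: "i < k" "j < n" by auto
  have "(A * family_sum m n X P) $$ (i, j) = (\<Sum>q<m. A $$ (i, q) * (\<Sum>x\<in>X. P x $$ (q, j)))"
    using ij carrier_matD[OF A] by (simp add: index_mult_mat_sum del: index_mult_mat(1))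
  also have "\<dots> = (\<Sum>x\<in>X. \<Sum>q<m. A $$ (i, q) * P x $$ (q, j))"
    unfolding sum_distrib_left by (rule sum.swap)
  also have "\<dots> = (\<Sum>x\<in>X. (A * P x) $$ (i, j))"
    using ij carrier_matD[OF A] carrier_matD[OF P]
    by (intro sum.cong) (simp_all add: index_mult_mat_sum del: index_mult_mat(1))
  finally show "(A * family_sum m n X P) $$ (i, j) = family_sum k n X (\<lambda>x. A * P x) $$ (i, j)"
    using ij by (simp del: index_mult_mat(1))
qed (use carrier_matD[OF A] in auto)

lemma mat_adjoint_family_sum:
  assumes "finite X" and P: "\<And>x. x \<in> X \<Longrightarrow> P x \<in> carrier_mat m n"
  shows "mat_adjoint (family_sum m n X P) = family_sum n m X (\<lambda>x. mat_adjoint (P x))"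
  using carrier_matD[OF P] assms(1)
  by (intro eq_matI) (auto simp: sum_conjugate intro!: sum.cong)

lemma transpose_family_sum:
  assumes P: "\<And>x. x \<in> X \<Longrightarrow> P x \<in> carrier_mat m n"
  shows "transpose_mat (family_sum m n X P) = family_sum n m X (\<lambda>x. transpose_mat (P x))"
  using carrier_matD[OF P] by (intro eq_matI) (auto intro!: sum.cong)

lemma family_sum_mult:
  fixes B :: "'a::comm_semiring_0 mat"
  assumes P: "\<And>x. x \<in> X \<Longrightarrow> P x \<in> carrier_mat m n" and B: "B \<in> carrier_mat n k"
  shows "family_sum m n X P * B = family_sum m k X (\<lambda>x. P x * B)"
proof -
  have "transpose_mat (family_sum m n X P * B) =
      transpose_mat B * family_sum n m X (\<lambda>x. transpose_mat (P x))"
    by (simp add: transpose_mult[OF family_sum_carrier B] transpose_family_sum[OF P])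
  also have "\<dots> = family_sum k m X (\<lambda>x. transpose_mat B * transpose_mat (P x))"
    using B P by (intro mult_family_sum) simp_all
  also have "\<dots> = family_sum k m X (\<lambda>x. transpose_mat (P x * B))"
    by (rule family_sum_cong) (simp add: transpose_mult[OF P B])
  also have "\<dots> = transpose_mat (family_sum m k X (\<lambda>x. P x * B))"
    by (rule transpose_family_sum[symmetric, OF mult_carrier_mat[OF P B]])
  finally show ?thesis
    by (simp only: transpose_mat_eq)
qed

lemma mult_family_sum_mult:
  fixes A B :: "'a::comm_semiring_0 mat"
  assumes A: "A \<in> carrier_mat k m" and P: "\<And>x. x \<in> X \<Longrightarrow> P x \<in> carrier_mat m n"
    and B: "B \<in> carrier_mat n q"
  shows "A * family_sum m n X P * B = family_sum k q X (\<lambda>x. A * P x * B)"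
proof -
  have "A * family_sum m n X P = family_sum k n X (\<lambda>x. A * P x)"
    by (rule mult_family_sum[OF A P])
  then show ?thesis
    using family_sum_mult[OF mult_carrier_mat[OF A P] B] by simp
qed

lemma mat_trace_family_sum:
  assumes P: "\<And>x. x \<in> X \<Longrightarrow> P x \<in> carrier_mat n n"
  shows "mat_trace (family_sum n n X P) = (\<Sum>x\<in>X. mat_trace (P x))"
proof -
  have "mat_trace (family_sum n n X P) = (\<Sum>i<n. \<Sum>x\<in>X. P x $$ (i, i))"
    by (simp add: mat_trace_def)
  also have "\<dots> = (\<Sum>x\<in>X. \<Sum>i<n. P x $$ (i, i))" by (rule sum.swap)
  also have "\<dots> = (\<Sum>x\<in>X. mat_trace (P x))"
    using carrier_matD[OF P] by (intro sum.cong) (simp_all add: mat_trace_def)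
  finally show ?thesis .
qed

section \<open>Block decompositions\<close>

abbreviation block_offset :: "(nat \<Rightarrow> nat) \<Rightarrow> nat \<Rightarrow> nat" where
  "block_offset n i \<equiv> \<Sum>j<i. n j"

abbreviation block_diag :: "nat \<Rightarrow> (nat \<Rightarrow> 'a::zero mat) \<Rightarrow> 'a mat" where
  "block_diag l A \<equiv> diag_block_mat (map A [0..<l])"

abbreviation block_stack :: "nat \<Rightarrow> nat \<Rightarrow> (nat \<Rightarrow> 'a::zero mat) \<Rightarrow> 'a mat" where
  "block_stack r l A \<equiv> stack_rows r (map A [0..<l])"

lemma block_offset_less:
  fixes n :: "nat \<Rightarrow> nat"
  assumes "i < l" "a < n i"
  shows "block_offset n i + a < block_offset n l"
proof -
  have "block_offset n i + a < block_offset n (Suc i)" using assms by simp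
  also have "\<dots> \<le> block_offset n l" using assms by (intro sum_mono2) auto
  finally show ?thesis .
qed

lemma block_offset_cases:
  fixes n :: "nat \<Rightarrow> nat"
  assumes "k < block_offset n l"
  obtains i a where "i < l" "a < n i" "k = block_offset n i + a"
proof -
  have "\<exists>i<l. \<exists>a<n i. k = block_offset n i + a"
    using assms
  proof (induction l)
    case (Suc l)
    show ?case
    proof (cases "k < block_offset n l")
      case True
      then show ?thesis using Suc.IH less_Suc_eq by blast
    next
      case False
      then show ?thesis using Suc.prems
        by (intro exI[of _ l] conjI exI[of _ "k - block_offset n l"]) auto
    qed
  qed simp
  then show thesis using that by blast
qed

lemma block_offset_inj:
  fixes n :: "nat \<Rightarrow> nat"
  assumes "a < n i" "b < n j" "block_offset n i + a = block_offset n j + b"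
  shows "i = j \<and> a = b"
proof -
  have "\<not> i < j" if "a < n i" "block_offset n i + a = block_offset n j + b" for i j a b
    using block_offset_less[of i j a n] that by auto
  then have "i = j" using assms by (metis linorder_neqE_nat)
  then show ?thesis using assms by simp
qed

lemma block_stack_carrier:
  assumes "\<And>i. i < l \<Longrightarrow> A i \<in> carrier_mat (n i) r"
  shows "block_stack r l A \<in> carrier_mat (block_offset n l) r"
  using assms
proof (induction l arbitrary: A n)
  case (Suc l)
  have "block_stack r (Suc l) A = A 0 @\<^sub>r block_stack r l (\<lambda>i. A (Suc i))"
    by (simp add: stack_rows_def map_upt_Suc del: upt_Suc)
  moreover have "block_stack r l (\<lambda>i. A (Suc i)) \<in> carrier_mat (block_offset (\<lambda>i. n (Suc i)) l) r"
    using Suc.prems by (intro Suc.IH) auto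
  ultimately show ?case
    using Suc.prems[of 0] by (simp add: sum.lessThan_Suc_shift del: sum.lessThan_Suc)
qed (simp add: stack_rows_def)

lemma index_block_stack:
  assumes "\<And>i. i < l \<Longrightarrow> A i \<in> carrier_mat (n i) r" and "i < l" "a < n i" "b < r"
  shows "block_stack r l A $$ (block_offset n i + a, b) = A i $$ (a, b)"
  using assms
proof (induction l arbitrary: A n i)
  case (Suc l)
  let ?B = "block_stack r l (\<lambda>i. A (Suc i))"
  have stack: "block_stack r (Suc l) A = A 0 @\<^sub>r ?B"
    by (simp add: stack_rows_def map_upt_Suc del: upt_Suc)
  have B: "?B \<in> carrier_mat (block_offset (\<lambda>i. n (Suc i)) l) r"
    using Suc.prems(1) by (intro block_stack_carrier) auto
  show ?case
  proof (cases i)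
    case 0
    then show ?thesis
      using Suc.prems(1)[of 0] Suc.prems(3,4) B unfolding stack by (simp add: append_rows_def)
  next
    case (Suc k)
    then have "?B $$ (block_offset (\<lambda>i. n (Suc i)) k + a, b) = A i $$ (a, b)"
      using Suc.prems Suc.IH[of "\<lambda>i. A (Suc i)" "\<lambda>i. n (Suc i)" k] by simp
    then show ?thesis
      using Suc Suc.prems(1)[of 0] Suc.prems(2-4) B block_offset_less[of k l a "\<lambda>i. n (Suc i)"]
      unfolding stack
      by (simp add: append_rows_def sum.lessThan_Suc_shift del: sum.lessThan_Suc)
  qed
qed simp

lemma block_diag_carrier:
  assumes "\<And>i. i < l \<Longrightarrow> A i \<in> carrier_mat (m i) (n i)"
  shows "block_diag l A \<in> carrier_mat (block_offset m l) (block_offset n l)"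
  using assms
  by (intro carrier_matI)
    (auto simp: dim_diag_block_mat sum_list_distinct_conv_sum_set atLeast0LessThan o_def
      intro!: sum.cong)

lemma index_block_diag:
  assumes "\<And>i. i < l \<Longrightarrow> A i \<in> carrier_mat (m i) (n i)"
    and "i < l" "a < m i" "j < l" "b < n j"
  shows "block_diag l A $$ (block_offset m i + a, block_offset n j + b) =
    (if i = j then A i $$ (a, b) else 0)"
  using assms
proof (induction l)
  case (Suc l)
  have D: "block_diag l A \<in> carrier_mat (block_offset m l) (block_offset n l)"
    using Suc.prems(1) by (intro block_diag_carrier) auto
  have last: "block_diag (Suc l) A =
      four_block_mat (block_diag l A) (0\<^sub>m (block_offset m l) (n l))
        (0\<^sub>m (m l) (block_offset n l)) (A l)"
    using D Suc.prems(1)[of l] by (simp add: diag_block_mat_last Let_def)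
  have inner: "block_diag l A $$ (block_offset m i + a, block_offset n j + b) =
      (if i = j then A i $$ (a, b) else 0)" if "i < l" "j < l"
    using Suc.prems that by (intro Suc.IH) auto
  show ?case
    unfolding last
    using inner D Suc.prems(1)[of l] Suc.prems(2-5)
      block_offset_less[of i l a m] block_offset_less[of j l b n]
    by (cases "i = l"; cases "j = l") (auto simp: less_Suc_eq)
qed simp

definition block_proj :: "(nat \<Rightarrow> nat) \<Rightarrow> nat \<Rightarrow> nat \<Rightarrow> 'a::zero_neq_one mat" where
  "block_proj n l i =
     mat (n i) (block_offset n l) (\<lambda>(a, b). if b = block_offset n i + a then 1 else 0)"

lemma block_proj_carrier [simp]: "block_proj n l i \<in> carrier_mat (n i) (block_offset n l)"
  and dim_block_proj [simp]: "dim_row (block_proj n l i) = n i"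
    "dim_col (block_proj n l i) = block_offset n l"
  by (auto simp: block_proj_def)

lemma index_block_proj_mult:
  fixes A :: "'a::semiring_1 mat"
  assumes "i < l" "a < n i" "b < dim_col A" "dim_row A = block_offset n l"
  shows "(block_proj n l i * A) $$ (a, b) = A $$ (block_offset n i + a, b)"
proof -
  have "(block_proj n l i * A) $$ (a, b) =
      (\<Sum>k<dim_row A. (if k = block_offset n i + a then 1 else 0) * A $$ (k, b))"
    using assms by (simp add: index_mult_mat_sum block_proj_def del: index_mult_mat(1))
  also have "\<dots> = (\<Sum>k<dim_row A. if k = block_offset n i + a then A $$ (k, b) else 0)"
    by (rule sum.cong) auto
  also have "\<dots> = A $$ (block_offset n i + a, b)"
    using block_offset_less[of i l a n, OF assms(1,2)] assms(4) by (simp add: sum.delta)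
  finally show ?thesis .
qed

lemma eq_mat_block_rowsI:
  fixes A B :: "'a::semiring_1 mat"
  assumes A: "A \<in> carrier_mat (block_offset n l) k" and B: "B \<in> carrier_mat (block_offset n l) k"
    and eq: "\<And>i. i < l \<Longrightarrow> block_proj n l i * A = block_proj n l i * B"
  shows "A = B"
proof (rule eq_matI)
  fix q b assume "q < dim_row B" "b < dim_col B"
  then have q: "q < block_offset n l" and b: "b < k" using B by auto
  obtain i a where ia: "i < l" "a < n i" "q = block_offset n i + a"
    using block_offset_cases[OF q] .
  show "A $$ (q, b) = B $$ (q, b)"
    using arg_cong[OF eq[OF ia(1)], of "\<lambda>M. M $$ (a, b)"] A B b ia
    by (simp add: index_block_proj_mult del: index_mult_mat(1))
qed (use A B in auto)

lemma block_proj_mult_adjoint: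
  assumes "i < l" "j < l"
  shows "block_proj n l i * mat_adjoint (block_proj n l j) =
    (if i = j then 1\<^sub>m (n i) else 0\<^sub>m (n i) (n j) :: 'a::conjugatable_field mat)"
    (is "_ = ?\<delta>")
proof (rule eq_matI)
  fix a b assume "a < dim_row ?\<delta>" "b < dim_col ?\<delta>"
  then have ab: "a < n i" "b < n j" by (auto split: if_splits)
  note less = block_offset_less[of i l a n, OF assms(1) ab(1)]
  have "(block_proj n l i * mat_adjoint (block_proj n l j)) $$ (a, b)
      = conjugate ((block_proj n l j :: 'a mat) $$ (b, block_offset n i + a))"
    using assms ab less by (simp add: index_block_proj_mult del: index_mult_mat(1))
  also have "\<dots> = (if i = j \<and> a = b then 1 else 0)"
    using ab less block_offset_inj[of a n i b j] by (auto simp: block_proj_def)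
  finally show "(block_proj n l i * mat_adjoint (block_proj n l j)) $$ (a, b) = ?\<delta> $$ (a, b)"
    using ab by auto
qed auto

lemma eq_mat_blocksI:
  fixes A B :: "'a::conjugatable_field mat"
  assumes A: "A \<in> carrier_mat (block_offset m l) (block_offset n k)"
    and B: "B \<in> carrier_mat (block_offset m l) (block_offset n k)"
    and eq: "\<And>i j. i < l \<Longrightarrow> j < k \<Longrightarrow> block_proj m l i * A * mat_adjoint (block_proj n k j) =
      block_proj m l i * B * mat_adjoint (block_proj n k j)"
  shows "A = B"
proof (rule eq_mat_block_rowsI[OF A B])
  fix i assume i: "i < l"
  note [simp] = carrier_matD[OF A] carrier_matD[OF B]
  have "mat_adjoint (block_proj m l i * A) = mat_adjoint (block_proj m l i * B)"
  proof (rule eq_mat_block_rowsI)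
    fix j assume j: "j < k"
    show "block_proj n k j * mat_adjoint (block_proj m l i * A) =
        block_proj n k j * mat_adjoint (block_proj m l i * B)"
      using arg_cong[OF eq[OF i j], of mat_adjoint] by (simp add: mat_adjoint_mult)
  qed (auto intro!: carrier_matI)
  then show "block_proj m l i * A = block_proj m l i * B"
    by (metis mat_adjoint_adjoint)
qed

lemma block_proj_resolution:
  "family_sum (block_offset n l) (block_offset n l) {..<l}
      (\<lambda>i. mat_adjoint (block_proj n l i) * block_proj n l i) =
    (1\<^sub>m (block_offset n l) :: 'a::conjugatable_field mat)"
    (is "?S = _")
proof (rule eq_mat_block_rowsI)
  let ?E = "block_proj n l :: nat \<Rightarrow> 'a mat"
  fix j assume j: "j < l"
  have "?E j * ?S =
      family_sum (n j) (block_offset n l) {..<l} (\<lambda>i. ?E j * (mat_adjoint (?E i) * ?E i))"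
    by (rule mult_family_sum) (auto intro!: mult_carrier_mat[of _ _ "n _"])
  also have "\<dots> =
      family_sum (n j) (block_offset n l) {..<l} (\<lambda>i. (?E j * mat_adjoint (?E i)) * ?E i)"
    by (rule family_sum_cong) (simp add: assoc_mult_mat_dim)
  also have "\<dots> = (?E j * mat_adjoint (?E j)) * ?E j"
    using j by (intro family_sum_single) (auto simp: block_proj_mult_adjoint)
  also have "\<dots> = ?E j * 1\<^sub>m (block_offset n l)"
    by (simp add: block_proj_mult_adjoint[OF j j] left_mult_one_mat[OF block_proj_carrier]
        right_mult_one_mat[OF block_proj_carrier])
  finally show "?E j * ?S = ?E j * 1\<^sub>m (block_offset n l)" .
qed auto

lemma block_proj_mult_stack:
  fixes A :: "nat \<Rightarrow> 'a::semiring_1 mat"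
  assumes A: "\<And>i. i < l \<Longrightarrow> A i \<in> carrier_mat (n i) r" and i: "i < l"
  shows "block_proj n l i * block_stack r l A = A i"
proof (rule eq_matI)
  note S = carrier_matD[OF block_stack_carrier[of l A n r, OF A]]
  note Ai = carrier_matD[OF A[OF i]]
  show "dim_row (block_proj n l i * block_stack r l A) = dim_row (A i)"
    "dim_col (block_proj n l i * block_stack r l A) = dim_col (A i)"
    using S Ai by auto
  fix a b assume "a < dim_row (A i)" "b < dim_col (A i)"
  then show "(block_proj n l i * block_stack r l A) $$ (a, b) = A i $$ (a, b)"
    using S Ai index_block_stack[of l A n r i a b, OF A] i by (subst index_block_proj_mult) auto
qed

lemma block_proj_mult_diag:
  fixes A :: "nat \<Rightarrow> 'a::semiring_1 mat"
  assumes A: "\<And>i. i < l \<Longrightarrow> A i \<in> carrier_mat (m i) (n i)" and i: "i < l"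
  shows "block_proj m l i * block_diag l A = A i * block_proj n l i"
proof (rule eq_matI)
  note D = carrier_matD[OF block_diag_carrier[of l A m n, OF A]]
  note Ai = carrier_matD[OF A[OF i]]
  show "dim_row (block_proj m l i * block_diag l A) = dim_row (A i * block_proj n l i)"
    "dim_col (block_proj m l i * block_diag l A) = dim_col (A i * block_proj n l i)"
    using D Ai by auto
  fix a k assume "a < dim_row (A i * block_proj n l i)" "k < dim_col (A i * block_proj n l i)"
  then have a: "a < m i" and k: "k < block_offset n l" using Ai by auto
  obtain j b where jb: "j < l" "b < n j" "k = block_offset n j + b"
    using block_offset_cases[OF k] .
  have "(block_proj m l i * block_diag l A) $$ (a, k) = (if i = j then A i $$ (a, b) else 0)"
    using D i a k jb index_block_diag[of l A m n i a j b, OF A]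
    by (subst index_block_proj_mult) auto
  also have "\<dots> = (\<Sum>c<n i. A i $$ (a, c) * (if i = j \<and> c = b then 1 else 0))"
    using jb by (auto simp: if_distrib cong: if_cong)
  also have "\<dots> = (\<Sum>c<n i. A i $$ (a, c) * block_proj n l i $$ (c, k))"
    using jb k block_offset_inj[of _ n i b j] by (intro sum.cong) (auto simp: block_proj_def)
  also have "\<dots> = (A i * block_proj n l i) $$ (a, k)"
    using a k Ai by (simp add: index_mult_mat_sum del: index_mult_mat(1))
  finally show "(block_proj m l i * block_diag l A) $$ (a, k) =
      (A i * block_proj n l i) $$ (a, k)" .
qed

lemma block_diag_mult:
  fixes A B :: "nat \<Rightarrow> 'a::semiring_1 mat"
  assumes A: "\<And>i. i < l \<Longrightarrow> A i \<in> carrier_mat (m i) (n i)"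
    and B: "\<And>i. i < l \<Longrightarrow> B i \<in> carrier_mat (n i) (k i)"
  shows "block_diag l (\<lambda>i. A i * B i) = block_diag l A * block_diag l B"
proof -
  have AB: "A i * B i \<in> carrier_mat (m i) (k i)" if "i < l" for i
    using mult_carrier_mat[OF A[OF that] B[OF that]] .
  note D_A = block_diag_carrier[of l A m n, OF A] and D_B = block_diag_carrier[of l B n k, OF B]
  note [simp] = carrier_matD[OF D_A] carrier_matD[OF D_B]
  show ?thesis
  proof (rule eq_mat_block_rowsI)
    show "block_diag l (\<lambda>i. A i * B i) \<in> carrier_mat (block_offset m l) (block_offset k l)"
      using AB by (rule block_diag_carrier)
    show "block_diag l A * block_diag l B \<in> carrier_mat (block_offset m l) (block_offset k l)"
      using mult_carrier_mat[OF D_A D_B] .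
    fix i assume i: "i < l"
    note [simp] = carrier_matD[OF A[OF i]] carrier_matD[OF B[OF i]]
    have "block_proj m l i * block_diag l (\<lambda>i. A i * B i) = A i * (B i * block_proj k l i)"
      by (simp add: block_proj_mult_diag[of l _ m k, OF AB i] assoc_mult_mat_dim)
    also have "\<dots> = (A i * block_proj n l i) * block_diag l B"
      by (simp add: block_proj_mult_diag[of l B n k, OF B i, symmetric] assoc_mult_mat_dim)
    also have "\<dots> = block_proj m l i * (block_diag l A * block_diag l B)"
      by (simp add: block_proj_mult_diag[of l A m n, OF A i, symmetric] assoc_mult_mat_dim)
    finally show "block_proj m l i * block_diag l (\<lambda>i. A i * B i) =
        block_proj m l i * (block_diag l A * block_diag l B)" .
  qed
qed

lemma block_diag_unitary:
  fixes U :: "nat \<Rightarrow> 'a::conjugatable_field mat"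
  assumes U: "\<And>i. i < l \<Longrightarrow> U i \<in> carrier (unitary_group (n i))"
  shows "block_diag l U \<in> carrier (unitary_group (block_offset n l))"
proof -
  let ?D = "block_diag l U" and ?d = "block_offset n l"
  let ?E = "block_proj n l :: nat \<Rightarrow> 'a mat"
  note U = unitary_groupD[OF U]
  have D: "?D \<in> carrier_mat ?d ?d"
    using U(1) by (rule block_diag_carrier)
  note [simp] = carrier_matD[OF D] U(2,3)
  have ED: "?E i * ?D = U i * ?E i" if "i < l" for i
    by (rule block_proj_mult_diag[OF U(1) that])
  have "?D * mat_adjoint ?D = 1\<^sub>m ?d"
  proof (rule eq_mat_blocksI)
    fix i j assume i: "i < l" and j: "j < l"
    have "?E i * (?D * mat_adjoint ?D) * mat_adjoint (?E j) =
        (?E i * ?D) * mat_adjoint (?E j * ?D)"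
      by (simp add: assoc_mult_mat_dim mat_adjoint_mult)
    also have "\<dots> = U i * (?E i * mat_adjoint (?E j)) * mat_adjoint (U j)"
      using i j by (simp add: ED assoc_mult_mat_dim mat_adjoint_mult)
    also have "\<dots> = ?E i * mat_adjoint (?E j)"
      using i j U(1,5) by (auto simp: block_proj_mult_adjoint)
    also have "\<dots> = ?E i * 1\<^sub>m ?d * mat_adjoint (?E j)" by simp
    finally show "?E i * (?D * mat_adjoint ?D) * mat_adjoint (?E j) =
        ?E i * 1\<^sub>m ?d * mat_adjoint (?E j)" .
  qed (use mult_carrier_mat[OF D mat_adjoint_carrier[OF D]] in auto)
  then show ?thesis
    using D mat_mult_left_right_inverse[OF D mat_adjoint_carrier[OF D]]
    by (simp add: unitary_group_def)
qed

lemma block_stack_gram: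
  fixes A :: "nat \<Rightarrow> 'a::conjugatable_field mat"
  assumes A: "\<And>i. i < l \<Longrightarrow> A i \<in> carrier_mat (n i) r"
  shows "mat_adjoint (block_stack r l A) * block_stack r l A =
    family_sum r r {..<l} (\<lambda>i. mat_adjoint (A i) * A i)"
proof -
  let ?S = "block_stack r l A" and ?E = "block_proj n l :: nat \<Rightarrow> 'a mat"
  have S: "?S \<in> carrier_mat (block_offset n l) r"
    using A by (rule block_stack_carrier)
  note [simp] = carrier_matD[OF S]
  have E: "mat_adjoint (?E i) * ?E i \<in> carrier_mat (block_offset n l) (block_offset n l)" for i
    using mult_carrier_mat[OF mat_adjoint_carrier[OF block_proj_carrier] block_proj_carrier] .
  have "mat_adjoint ?S * ?S = mat_adjoint ?S * 1\<^sub>m (block_offset n l) * ?S"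
    using S by (simp add: right_mult_one_mat[OF mat_adjoint_carrier])
  also have "\<dots> = family_sum r r {..<l} (\<lambda>i. mat_adjoint ?S * (mat_adjoint (?E i) * ?E i) * ?S)"
    unfolding block_proj_resolution[symmetric]
    by (rule mult_family_sum_mult[OF mat_adjoint_carrier[OF S] E S])
  also have "\<dots> = family_sum r r {..<l} (\<lambda>i. mat_adjoint (?E i * ?S) * (?E i * ?S))"
    by (rule family_sum_cong) (simp add: mat_adjoint_mult assoc_mult_mat_dim)
  also have "\<dots> = family_sum r r {..<l} (\<lambda>i. mat_adjoint (A i) * A i)"
    by (rule family_sum_cong) (simp add: block_proj_mult_stack[OF A])
  finally show ?thesis .
qed

lemma weighted_stack_isometry:
  fixes \<Phi> :: "nat \<Rightarrow> 'a::real_or_complex mat"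
  assumes \<Phi>: "\<And>i. i < l \<Longrightarrow> is_isometry (n i) r (\<Phi> i)"
    and weights: "(\<Sum>i<l. (norm (c i))\<^sup>2) = 1"
  shows "is_isometry (block_offset n l) r (block_stack r l (\<lambda>i. c i \<cdot>\<^sub>m \<Phi> i))"
    (is "is_isometry _ _ ?S")
proof -
  note \<Phi> = is_isometryD[OF \<Phi>]
  have carrier: "c i \<cdot>\<^sub>m \<Phi> i \<in> carrier_mat (n i) r" if "i < l" for i
    using \<Phi>(1)[OF that] by simp
  have "mat_adjoint ?S * ?S =
      family_sum r r {..<l} (\<lambda>i. mat_adjoint (c i \<cdot>\<^sub>m \<Phi> i) * (c i \<cdot>\<^sub>m \<Phi> i))"
    by (rule block_stack_gram[OF carrier])
  also have "\<dots> = family_sum r r {..<l} (\<lambda>i. of_real ((norm (c i))\<^sup>2) \<cdot>\<^sub>m 1\<^sub>m r)"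
  proof (rule family_sum_cong)
    fix i assume "i \<in> {..<l}"
    then show "mat_adjoint (c i \<cdot>\<^sub>m \<Phi> i) * (c i \<cdot>\<^sub>m \<Phi> i) = of_real ((norm (c i))\<^sup>2) \<cdot>\<^sub>m 1\<^sub>m r"
      using conjugate_mult_self[of "c i"]
      by (auto simp: mat_adjoint_smult mult_smult_mat_dim \<Phi>(4) mult.commute intro!: eq_matI)
  qed
  also have "\<dots> = of_real (\<Sum>i<l. (norm (c i))\<^sup>2) \<cdot>\<^sub>m 1\<^sub>m r"
    by (intro eq_matI) auto
  also have "\<dots> = 1\<^sub>m r"
    unfolding weights by (intro eq_matI) auto
  finally show ?thesis
    using block_stack_carrier[of l _ n r, OF carrier] by (simp add: is_isometry_def)
qed

lemma dimension_weighted_stack: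
  fixes \<Phi> :: "nat \<Rightarrow> 'a::real_or_complex mat" and n :: "nat \<Rightarrow> nat" and l r :: nat
  defines "d \<equiv> block_offset n l"
  defines "S \<equiv> block_stack r l (\<lambda>i. of_real (sqrt (real (n i) / real d)) \<cdot>\<^sub>m \<Phi> i)"
  assumes \<Phi>: "\<And>i. i < l \<Longrightarrow> is_isometry (n i) r (\<Phi> i)"
    and "l \<ge> 1" and pos: "\<And>i. i < l \<Longrightarrow> n i > 0"
  shows "is_isometry d r S"
    and "i < l \<Longrightarrow> (frobenius_norm (block_proj n l i * S))\<^sup>2 = real r / real d * real (n i)"
proof -
  let ?w = "\<lambda>i. of_real (sqrt (real (n i) / real d)) :: 'a"
  have "d > 0"
    unfolding d_def using \<open>l \<ge> 1\<close> pos by (intro sum_pos2[of _ 0]) auto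
  moreover have "(\<Sum>i<l. real (n i)) = real d"
    by (simp add: d_def)
  ultimately have "(\<Sum>i<l. (norm (?w i))\<^sup>2) = 1"
    by (simp flip: sum_divide_distrib)
  then show "is_isometry d r S"
    unfolding S_def d_def by (intro weighted_stack_isometry \<Phi>)
  show "(frobenius_norm (block_proj n l i * S))\<^sup>2 = real r / real d * real (n i)" if i: "i < l"
  proof -
    have "block_proj n l i * S = ?w i \<cdot>\<^sub>m \<Phi> i"
      unfolding S_def using is_isometryD(1)[OF \<Phi>] i by (intro block_proj_mult_stack) auto
    then show ?thesis
      by (simp add: frobenius_norm_smult power_mult_distrib frobenius_norm_isometry[OF \<Phi>[OF i]])
  qed
qed

section \<open>Direct sums of representations\<close>

abbreviation direct_sum_rep :: "nat \<Rightarrow> (nat \<Rightarrow> 'g \<Rightarrow> 'a::zero mat) \<Rightarrow> 'g \<Rightarrow> 'a mat" where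
  "direct_sum_rep l \<rho> \<equiv> \<lambda>g. block_diag l (\<lambda>i. \<rho> i g)"

lemma direct_sum_rep_unitary:
  fixes \<rho> :: "nat \<Rightarrow> 'g \<Rightarrow> 'a::conjugatable_field mat"
  assumes \<rho>: "\<And>i. i < l \<Longrightarrow> \<rho> i \<in> hom G (unitary_group (n i))"
  shows "direct_sum_rep l \<rho> \<in> hom G (unitary_group (block_offset n l))"
proof (rule homI)
  show "direct_sum_rep l \<rho> g \<in> carrier (unitary_group (block_offset n l))" if "g \<in> carrier G" for g
    using unitary_rep_carrier[OF \<rho>] that by (intro block_diag_unitary)
  fix g h assume g: "g \<in> carrier G" and h: "h \<in> carrier G"
  have map_mult: "map (\<lambda>i. \<rho> i (g \<otimes>\<^bsub>G\<^esub> h)) [0..<l] = map (\<lambda>i. \<rho> i g * \<rho> i h) [0..<l]"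
    using \<rho> g h by (auto simp: hom_def unitary_group_def)
  show "direct_sum_rep l \<rho> (g \<otimes>\<^bsub>G\<^esub> h) =
      direct_sum_rep l \<rho> g \<otimes>\<^bsub>unitary_group (block_offset n l)\<^esub> direct_sum_rep l \<rho> h"
    unfolding map_mult
    using block_diag_mult[of l "\<lambda>i. \<rho> i g" n n "\<lambda>i. \<rho> i h" n] unitary_rep_carrier_mat[OF \<rho>] g h
    by (simp add: unitary_group_def)
qed

lemma block_proj_intertwiner:
  fixes \<rho> :: "nat \<Rightarrow> 'g \<Rightarrow> 'a::semiring_1 mat"
  assumes \<rho>: "\<And>i g. i < l \<Longrightarrow> g \<in> carrier G \<Longrightarrow> \<rho> i g \<in> carrier_mat (n i) (n i)" and i: "i < l"
  shows "intertwiner G (block_offset n l) (direct_sum_rep l \<rho>) (n i) (\<rho> i) (block_proj n l i)"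
  using \<rho> i by (intro intertwinerI block_diag_carrier block_proj_mult_diag) auto

lemma block_stack_intertwiner:
  fixes \<rho> :: "nat \<Rightarrow> 'g \<Rightarrow> 'a::semiring_1 mat"
  assumes A: "\<And>i. i < l \<Longrightarrow> intertwiner K r \<pi> (n i) (\<rho> i) (A i)"
    and \<pi>: "\<And>h. h \<in> carrier K \<Longrightarrow> \<pi> h \<in> carrier_mat r r"
  shows "intertwiner K r \<pi> (block_offset n l) (direct_sum_rep l \<rho>) (block_stack r l A)"
proof (rule intertwinerI)
  let ?S = "block_stack r l A"
  note A = intertwinerD[OF A]
  show S: "?S \<in> carrier_mat (block_offset n l) r"
    using A(1) by (rule block_stack_carrier)
  fix h assume h: "h \<in> carrier K"
  show \<rho>: "direct_sum_rep l \<rho> h \<in> carrier_mat (block_offset n l) (block_offset n l)"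
    using A(5) h by (intro block_diag_carrier)
  show "\<pi> h \<in> carrier_mat r r" using \<pi>[OF h] .
  note [simp] = carrier_matD[OF S] carrier_matD[OF \<rho>] carrier_matD[OF \<pi>[OF h]]
  show "?S * \<pi> h = direct_sum_rep l \<rho> h * ?S"
  proof (rule eq_mat_block_rowsI)
    fix i assume i: "i < l"
    let ?E = "block_proj n l i"
    note [simp] = carrier_matD[OF A(5)[OF i h]]
    have "?E * (?S * \<pi> h) = A i * \<pi> h"
      by (simp add: block_proj_mult_stack[OF A(1) i] flip: assoc_mult_mat_dim)
    also have "\<dots> = \<rho> i h * (?E * ?S)"
      by (simp add: A(6)[OF i h] block_proj_mult_stack[OF A(1) i])
    also have "\<dots> = (?E * direct_sum_rep l \<rho> h) * ?S"
      by (simp add: block_proj_mult_diag[OF A(5)[OF _ h] i] assoc_mult_mat_dim)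
    also have "\<dots> = ?E * (direct_sum_rep l \<rho> h * ?S)"
      by (simp add: assoc_mult_mat_dim)
    finally show "?E * (?S * \<pi> h) = ?E * (direct_sum_rep l \<rho> h * ?S)" .
  qed (auto intro!: carrier_matI)
qed

lemma weighted_stack_image_invariant:
  fixes \<rho> :: "nat \<Rightarrow> 'g \<Rightarrow> 'a::conjugatable_field mat"
  assumes \<pi>: "\<pi> \<in> hom K (unitary_group r)"
    and A: "\<And>i. i < l \<Longrightarrow> intertwiner K r \<pi> (n i) (\<rho> i) (A i)" and h: "h \<in> carrier K"
  shows "(*\<^sub>v) (direct_sum_rep l \<rho> h) ` mat_image (block_stack r l (\<lambda>i. c i \<cdot>\<^sub>m A i)) =
    mat_image (block_stack r l (\<lambda>i. c i \<cdot>\<^sub>m A i))"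
proof (rule mat_image_intertwiner_invariant[OF \<pi> _ h])
  show "intertwiner K r \<pi> (block_offset n l) (direct_sum_rep l \<rho>)
      (block_stack r l (\<lambda>i. c i \<cdot>\<^sub>m A i))"
    using A unitary_rep_carrier_mat[OF \<pi>] by (intro block_stack_intertwiner intertwiner_smult)
qed

lemma self_adjoint_direct_sum_intertwiner_scalar:
  fixes S :: "'a::real_or_complex mat"
  assumes \<rho>: "\<And>i. i < l \<Longrightarrow> \<rho> i \<in> hom G (unitary_group (n i))"
    and irr: "\<And>i. i < l \<Longrightarrow> irreducible_rep G (n i) (\<rho> i)"
    and inequiv: "\<And>i j. i < l \<Longrightarrow> j < l \<Longrightarrow> i \<noteq> j \<Longrightarrow>
      \<not> equivalent_reps G (n i) (\<rho> i) (n j) (\<rho> j)"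
    and S: "intertwiner G (block_offset n l) (direct_sum_rep l \<rho>)
      (block_offset n l) (direct_sum_rep l \<rho>) S"
    and adj: "mat_adjoint S = S"
    and trace: "\<And>i. i < l \<Longrightarrow>
      mat_trace (block_proj n l i * S * mat_adjoint (block_proj n l i)) = c * of_nat (n i)"
  shows "S = c \<cdot>\<^sub>m 1\<^sub>m (block_offset n l)"
proof -
  let ?E = "block_proj n l :: nat \<Rightarrow> 'a mat" and ?d = "block_offset n l"
  define B where "B i j = ?E i * S * mat_adjoint (?E j)" for i j
  note [simp] = intertwinerD(2,3)[OF S]
  have E: "intertwiner G ?d (direct_sum_rep l \<rho>) (n i) (\<rho> i) (?E i)" if "i < l" for i
    using unitary_rep_carrier_mat[OF \<rho>] that by (intro block_proj_intertwiner)
  have B: "intertwiner G (n j) (\<rho> j) (n i) (\<rho> i) (B i j)" if "i < l" "j < l" for i j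
    unfolding B_def
    using intertwiner_adjoint[OF direct_sum_rep_unitary[of l, OF \<rho>] \<rho>[OF that(2)] E[OF that(2)]]
    by (rule intertwiner_mult[OF _ intertwiner_mult[OF S E[OF that(1)]]])
  have off_diagonal: "B i j = 0\<^sub>m (n i) (n j)" if "i < l" "j < l" "i \<noteq> j" for i j
    using that \<rho> irr inequiv by (intro inequivalent_intertwiner_zero[OF _ _ _ _ _ B]) auto
  have diagonal: "B i i = c \<cdot>\<^sub>m 1\<^sub>m (n i)" if i: "i < l" for i
  proof -
    have "mat_adjoint (B i i) = B i i"
      by (simp add: B_def mat_adjoint_mult assoc_mult_mat_dim adj)
    then obtain b where b: "B i i = b \<cdot>\<^sub>m 1\<^sub>m (n i)"
      by (rule self_adjoint_intertwiner_scalar[OF irr[OF i] B[OF i i]])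
    have "b * of_nat (n i) = c * of_nat (n i)"
      using trace[OF i] by (simp add: b flip: B_def)
    then show ?thesis
      using b irreducible_rep_dim_pos[OF irr[OF i]] by simp
  qed
  show ?thesis
  proof (rule eq_mat_blocksI)
    show "S \<in> carrier_mat ?d ?d" "c \<cdot>\<^sub>m 1\<^sub>m ?d \<in> carrier_mat ?d ?d"
      using intertwinerD(1)[OF S] by simp_all
    fix i j assume i: "i < l" and j: "j < l"
    have "?E i * S * mat_adjoint (?E j) = c \<cdot>\<^sub>m (?E i * mat_adjoint (?E j))"
      using diagonal[OF i] off_diagonal[OF i j]
      by (auto simp: block_proj_mult_adjoint[OF i j] simp flip: B_def)
    also have "\<dots> = ?E i * (c \<cdot>\<^sub>m 1\<^sub>m ?d) * mat_adjoint (?E j)"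
      using right_mult_one_mat[OF block_proj_carrier] by (simp add: mult_smult_mat_dim)
    finally show "?E i * S * mat_adjoint (?E j) = ?E i * (c \<cdot>\<^sub>m 1\<^sub>m ?d) * mat_adjoint (?E j)" .
  qed
qed

section \<open>Fusion frames and their symmetries\<close>

definition fusion_frame_op ::
  "nat \<Rightarrow> 'x set \<Rightarrow> ('x \<Rightarrow> 'a::conjugatable_field mat) \<Rightarrow> 'a mat" where
  "fusion_frame_op d X \<Phi> = family_sum d d X (\<lambda>x. \<Phi> x * mat_adjoint (\<Phi> x))"

lemma fusion_frame_op_carrier [simp]: "fusion_frame_op d X \<Phi> \<in> carrier_mat d d"
  and dim_fusion_frame_op [simp]:
    "dim_row (fusion_frame_op d X \<Phi>) = d" "dim_col (fusion_frame_op d X \<Phi>) = d"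
  by (simp_all add: fusion_frame_op_def)

lemma mat_adjoint_fusion_frame_op:
  assumes "finite X" and \<Phi>: "\<And>x. x \<in> X \<Longrightarrow> \<Phi> x \<in> carrier_mat d r"
  shows "mat_adjoint (fusion_frame_op d X \<Phi>) = fusion_frame_op d X \<Phi>"
  using mat_adjoint_family_sum[OF assms(1) mult_adjoint_carrier[OF \<Phi>]]
  by (simp add: fusion_frame_op_def mat_adjoint_mult)

lemma mult_fusion_frame_op_mult_adjoint:
  assumes A: "A \<in> carrier_mat m d" and \<Phi>: "\<And>x. x \<in> X \<Longrightarrow> \<Phi> x \<in> carrier_mat d r"
  shows "A * fusion_frame_op d X \<Phi> * mat_adjoint A = fusion_frame_op m X (\<lambda>x. A * \<Phi> x)"
proof -
  have "A * fusion_frame_op d X \<Phi> * mat_adjoint A =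
      family_sum m m X (\<lambda>x. A * (\<Phi> x * mat_adjoint (\<Phi> x)) * mat_adjoint A)"
    unfolding fusion_frame_op_def
    by (rule mult_family_sum_mult[OF A mult_adjoint_carrier[OF \<Phi>] mat_adjoint_carrier[OF A]])
  also have "\<dots> = fusion_frame_op m X (\<lambda>x. A * \<Phi> x)"
    unfolding fusion_frame_op_def
    using carrier_matD[OF A] carrier_matD[OF \<Phi>]
    by (intro family_sum_cong) (simp add: mat_adjoint_mult assoc_mult_mat_dim)
  finally show ?thesis .
qed

lemma mat_trace_fusion_frame_op:
  fixes \<Phi> :: "'x \<Rightarrow> 'a::real_or_complex mat"
  assumes \<Phi>: "\<And>x. x \<in> X \<Longrightarrow> \<Phi> x \<in> carrier_mat d r"
  shows "mat_trace (fusion_frame_op d X \<Phi>) = of_real (\<Sum>x\<in>X. (frobenius_norm (\<Phi> x))\<^sup>2)"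
proof -
  have "mat_trace (fusion_frame_op d X \<Phi>) = (\<Sum>x\<in>X. mat_trace (\<Phi> x * mat_adjoint (\<Phi> x)))"
    unfolding fusion_frame_op_def by (rule mat_trace_family_sum[OF mult_adjoint_carrier[OF \<Phi>]])
  also have "\<dots> = (\<Sum>x\<in>X. mat_trace (mat_adjoint (\<Phi> x) * \<Phi> x))"
    by (intro sum.cong refl mat_trace_comm) auto
  finally show ?thesis by (simp add: mat_trace_adjoint_mult_self)
qed

lemma fusion_frame_op_commutes:
  assumes U: "U \<in> carrier (unitary_group d)" and s: "bij_betw s X X"
    and \<Phi>: "\<And>x. x \<in> X \<Longrightarrow> isometry_onto d r (\<Phi> x) (V x)"
    and perm: "\<And>x. x \<in> X \<Longrightarrow> (*\<^sub>v) U ` V x = V (s x)"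
  shows "fusion_frame_op d X \<Phi> * U = U * fusion_frame_op d X \<Phi>"
proof -
  let ?S = "fusion_frame_op d X \<Phi>"
  note U' = unitary_groupD[OF U]
  note [simp] = U'(2,3)
  have proj: "(U * \<Phi> x) * mat_adjoint (U * \<Phi> x) = \<Phi> (s x) * mat_adjoint (\<Phi> (s x))"
    if x: "x \<in> X" for x
  proof -
    have "isometry_onto d r (U * \<Phi> x) (V (s x))"
      using isometry_onto_unitary_mult[OF U \<Phi>[OF x]] by (simp add: perm[OF x])
    moreover have "isometry_onto d r (\<Phi> (s x)) (V (s x))"
      using s x by (intro \<Phi>) (auto simp: bij_betw_def)
    ultimately show ?thesis
      using orth_projection_isometry orth_projection_unique by blast
  qed
  have "U * ?S * mat_adjoint U = fusion_frame_op d X (\<lambda>x. U * \<Phi> x)"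
    by (rule mult_fusion_frame_op_mult_adjoint[OF U'(1) isometry_ontoD(2)[OF \<Phi>]])
  also have "\<dots> = family_sum d d X (\<lambda>x. \<Phi> (s x) * mat_adjoint (\<Phi> (s x)))"
    unfolding fusion_frame_op_def by (rule family_sum_cong) (rule proj)
  also have "\<dots> = ?S"
    unfolding fusion_frame_op_def by (rule family_sum_reindex[OF s])
  finally have "?S * U = U * ?S * mat_adjoint U * U" by simp
  also have "\<dots> = U * ?S * (mat_adjoint U * U)"
    by (simp add: assoc_mult_mat_dim)
  also have "\<dots> = U * ?S"
    by (simp add: U'(4) right_mult_one_mat[OF mult_carrier_mat[OF U'(1) fusion_frame_op_carrier]])
  finally show ?thesis .
qed

lemma tight_fusion_frameI:
  assumes \<Phi>: "\<And>x. x \<in> X \<Longrightarrow> isometry_onto d r (\<Phi> x) (V x)"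
    and scalar: "fusion_frame_op d X \<Phi> = c \<cdot>\<^sub>m 1\<^sub>m d"
  shows "tight_fusion_frame d r X V"
  unfolding tight_fusion_frame_def
proof (intro conjI ballI exI)
  show "is_subspace d (V x)" "subspace_dim d (V x) = r" if "x \<in> X" for x
    using isometry_onto_subspace[OF \<Phi>[OF that]] .
  show "orth_projection d (\<Phi> x * mat_adjoint (\<Phi> x)) (V x)" if "x \<in> X" for x
    using orth_projection_isometry[OF \<Phi>[OF that]] .
  show "mat d d (\<lambda>(i, j). \<Sum>x\<in>X. (\<Phi> x * mat_adjoint (\<Phi> x)) $$ (i, j)) = c \<cdot>\<^sub>m 1\<^sub>m d"
    using scalar unfolding fusion_frame_op_def family_sum_def .
qed

lemma doubly_homogeneous_unitary_invariant:
  assumes dh: "doubly_homogeneous G X \<sigma>"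
    and aut: "\<sigma> ` carrier G \<subseteq> ensemble_automorphisms d X V"
    and sym: "\<And>x y. x \<in> X \<Longrightarrow> y \<in> X \<Longrightarrow> P (V x) (V y) \<Longrightarrow> P (V y) (V x)"
    and inv: "\<And>U x y. U \<in> carrier (unitary_group d) \<Longrightarrow> x \<in> X \<Longrightarrow> y \<in> X \<Longrightarrow> P (V x) (V y) \<Longrightarrow>
      P ((*\<^sub>v) U ` V x) ((*\<^sub>v) U ` V y)"
    and xy: "x \<in> X" "y \<in> X" "x \<noteq> y" "P (V x) (V y)"
    and xy': "x' \<in> X" "y' \<in> X" "x' \<noteq> y'"
  shows "P (V x') (V y')"
proof -
  obtain g where g: "g \<in> carrier G" "{\<sigma> g x, \<sigma> g y} = {x', y'}"
    using dh xy xy' unfolding doubly_homogeneous_def by blast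
  then have pair: "\<sigma> g x = x' \<and> \<sigma> g y = y' \<or> \<sigma> g x = y' \<and> \<sigma> g y = x'"
    by (auto simp: doubleton_eq_iff)
  have "\<sigma> g \<in> ensemble_automorphisms d X V"
    using aut g(1) by blast
  then obtain U where U: "U \<in> carrier (unitary_group d)"
    and perm: "\<forall>x\<in>X. (*\<^sub>v) U ` V x = V (\<sigma> g x)"
    unfolding ensemble_automorphisms_def by blast
  have "P (V (\<sigma> g x)) (V (\<sigma> g y))"
    using inv[OF U xy(1,2,4)] perm xy(1,2) by simp
  with pair show ?thesis
    using sym xy' by metis
qed

lemma doubly_homogeneous_equi_chordal:
  assumes dh: "doubly_homogeneous G X \<sigma>"
    and aut: "\<sigma> ` carrier G \<subseteq> ensemble_automorphisms d X V"
    and \<Phi>: "\<And>x. x \<in> X \<Longrightarrow> isometry_onto d r (\<Phi> x) (V x)"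
  shows "equi_chordal d r X V"
proof (cases "\<exists>x\<in>X. \<exists>y\<in>X. x \<noteq> y")
  case True
  then obtain x y where xy: "x \<in> X" "y \<in> X" "x \<noteq> y" by blast
  let ?P = "\<lambda>W W'. chordal_dist d r W W' = chordal_dist d r (V x) (V y)"
  have "?P (V x') (V y')" if "x' \<in> X" "y' \<in> X" "x' \<noteq> y'" for x' y'
    by (rule doubly_homogeneous_unitary_invariant[where P = ?P, OF dh aut _ _ xy refl that])
      (simp_all add: chordal_dist_commute[OF \<Phi> \<Phi>] chordal_dist_unitary[OF _ \<Phi> \<Phi>])
  then show ?thesis unfolding equi_chordal_def by blast
next
  case False
  then show ?thesis unfolding equi_chordal_def by blast
qed

lemma doubly_homogeneous_equi_isoclinic:
  assumes dh: "doubly_homogeneous G X \<sigma>"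
    and aut: "\<sigma> ` carrier G \<subseteq> ensemble_automorphisms d X V"
    and xy: "x \<in> X" "y \<in> X" "x \<noteq> y" and iso: "isoclinic d r (V x) (V y)"
  shows "equi_isoclinic d r X V"
proof -
  obtain \<alpha> where \<alpha>: "alpha_isoclinic d r \<alpha> (V x) (V y)"
    using iso by (auto simp: isoclinic_def)
  have "alpha_isoclinic d r \<alpha> (V x') (V y')" if "x' \<in> X" "y' \<in> X" "x' \<noteq> y'" for x' y'
    by (rule doubly_homogeneous_unitary_invariant[where P = "alpha_isoclinic d r \<alpha>",
          OF dh aut _ _ xy \<alpha> that])
      (simp_all add: alpha_isoclinic_commute alpha_isoclinic_unitary)
  then show ?thesis unfolding equi_isoclinic_def by blast
qed

section \<open>Orbits of a subspace under a unitary representation\<close>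

locale orbit_ensemble = group_action G X \<sigma>
  for G :: "('g, 'b) monoid_scheme" and X :: "'x set" and \<sigma> :: "'g \<Rightarrow> 'x \<Rightarrow> 'x" +
  fixes x0 :: 'x and t :: "'x \<Rightarrow> 'g" and d r :: nat
    and \<rho> :: "'g \<Rightarrow> 'a::real_or_complex mat" and \<Psi> :: "'a mat" and W :: "'a vec set"
  assumes base_point: "x0 \<in> X"
    and transversal: "\<And>x. x \<in> X \<Longrightarrow> t x \<in> carrier G" "\<And>x. x \<in> X \<Longrightarrow> \<sigma> (t x) x0 = x"
    and rep: "\<rho> \<in> hom G (unitary_group d)"
    and isometry: "isometry_onto d r \<Psi> W"
    and stabilizer_invariant: "\<And>h. h \<in> stabilizer G \<sigma> x0 \<Longrightarrow> (*\<^sub>v) (\<rho> h) ` W = W"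
begin

sublocale grp: group G
  using group_hom group_hom.axioms(1) by blast

definition orbit_subspace :: "'x \<Rightarrow> 'a vec set" where
  "orbit_subspace x = (*\<^sub>v) (\<rho> (t x)) ` W"

definition orbit_isometry :: "'x \<Rightarrow> 'a mat" where
  "orbit_isometry x = \<rho> (t x) * \<Psi>"

abbreviation frame_op :: "'a mat" where
  "frame_op \<equiv> fusion_frame_op d X orbit_isometry"

lemma rep_unitary: "g \<in> carrier G \<Longrightarrow> \<rho> g \<in> carrier (unitary_group d)"
  using rep by (rule unitary_rep_carrier)

lemma orbit_isometry_onto: "x \<in> X \<Longrightarrow> isometry_onto d r (orbit_isometry x) (orbit_subspace x)"
  unfolding orbit_isometry_def orbit_subspace_def
  using isometry_onto_unitary_mult[OF rep_unitary[OF transversal(1)] isometry] .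

lemma rep_image_image:
  assumes g: "g \<in> carrier G" and h: "h \<in> carrier G"
  shows "(*\<^sub>v) (\<rho> g) ` (*\<^sub>v) (\<rho> h) ` W = (*\<^sub>v) (\<rho> (g \<otimes>\<^bsub>G\<^esub> h)) ` W"
proof -
  have "\<rho> (g \<otimes>\<^bsub>G\<^esub> h) = \<rho> g * \<rho> h"
    using rep g h by (auto simp: hom_def unitary_group_def)
  moreover have "W \<subseteq> carrier_vec d"
    using isometry_ontoD(2,6)[OF isometry] by (auto simp: mat_image_def)
  ultimately show ?thesis
    unfolding image_image
    using assoc_mult_mat_vec[OF unitary_rep_carrier_mat[OF rep g] unitary_rep_carrier_mat[OF rep h]]
    by (intro image_cong) auto
qed

lemma rep_image_base:
  assumes g: "g \<in> carrier G"
  shows "(*\<^sub>v) (\<rho> g) ` W = orbit_subspace (\<sigma> g x0)"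
proof -
  let ?y = "\<sigma> g x0"
  have y: "?y \<in> X" using element_image[OF g base_point refl] .
  let ?h = "inv\<^bsub>G\<^esub> (t ?y) \<otimes>\<^bsub>G\<^esub> g"
  note ty = transversal[OF y]
  have h: "?h \<in> carrier G" using g ty(1) by simp
  have "\<sigma> ?h x0 = \<sigma> (inv\<^bsub>G\<^esub> (t ?y)) ?y"
    using composition_rule[OF base_point _ g] ty(1) by simp
  also have "\<dots> = x0" using orbit_sym_aux[OF ty(1) base_point ty(2)] .
  finally have "?h \<in> stabilizer G \<sigma> x0" using h by (simp add: stabilizer_def)
  then have "orbit_subspace ?y = (*\<^sub>v) (\<rho> (t ?y)) ` (*\<^sub>v) (\<rho> ?h) ` W"
    by (simp add: orbit_subspace_def stabilizer_invariant)
  also have "\<dots> = (*\<^sub>v) (\<rho> (t ?y \<otimes>\<^bsub>G\<^esub> ?h)) ` W"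
    by (rule rep_image_image[OF ty(1) h])
  also have "t ?y \<otimes>\<^bsub>G\<^esub> ?h = g"
    using g ty(1) by (simp flip: grp.m_assoc)
  finally show ?thesis by simp
qed

lemma rep_image_orbit_subspace:
  assumes g: "g \<in> carrier G" and x: "x \<in> X"
  shows "(*\<^sub>v) (\<rho> g) ` orbit_subspace x = orbit_subspace (\<sigma> g x)"
proof -
  note tx = transversal[OF x]
  have "(*\<^sub>v) (\<rho> g) ` orbit_subspace x = (*\<^sub>v) (\<rho> (g \<otimes>\<^bsub>G\<^esub> t x)) ` W"
    unfolding orbit_subspace_def by (rule rep_image_image[OF g tx(1)])
  also have "\<dots> = orbit_subspace (\<sigma> (g \<otimes>\<^bsub>G\<^esub> t x) x0)"
    using g tx(1) by (intro rep_image_base) simp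
  also have "\<sigma> (g \<otimes>\<^bsub>G\<^esub> t x) x0 = \<sigma> g x"
    using composition_rule[OF base_point g tx(1)] tx(2) by simp
  finally show ?thesis .
qed

lemma orbit_subspace_base: "orbit_subspace x0 = W"
  using stabilizer_invariant[of "t x0"] transversal[OF base_point]
  by (simp add: orbit_subspace_def stabilizer_def)

lemma action_automorphisms: "\<sigma> ` carrier G \<subseteq> ensemble_automorphisms d X orbit_subspace"
proof (rule image_subsetI)
  fix g assume g: "g \<in> carrier G"
  then have "\<sigma> g \<in> carrier (BijGroup X)"
    using bij_prop0 by (simp add: BijGroup_def)
  then show "\<sigma> g \<in> ensemble_automorphisms d X orbit_subspace"
    unfolding ensemble_automorphisms_def
    using rep_unitary[OF g] rep_image_orbit_subspace[OF g] by blast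
qed

lemma frame_op_intertwiner: "intertwiner G d \<rho> d \<rho> frame_op"
proof (rule intertwinerI)
  fix g assume g: "g \<in> carrier G"
  show "\<rho> g \<in> carrier_mat d d" "\<rho> g \<in> carrier_mat d d"
    using unitary_rep_carrier_mat[OF rep g] by simp_all
  have "bij_betw (\<sigma> g) X X"
    using bij_prop0[OF g] by (simp add: Bij_def)
  then show "frame_op * \<rho> g = \<rho> g * frame_op"
    using rep_unitary[OF g] orbit_isometry_onto rep_image_orbit_subspace[OF g]
    by (intro fusion_frame_op_commutes)
qed simp

lemma mat_trace_frame_op_compression:
  assumes \<rho>': "\<rho>' \<in> hom G (unitary_group m)" and E: "intertwiner G d \<rho> m \<rho>' E"
  shows "mat_trace (E * frame_op * mat_adjoint E) =
    of_real (real (card X) * (frobenius_norm (E * \<Psi>))\<^sup>2)"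
proof -
  note E = intertwinerD[OF E]
  note \<Psi> = isometry_ontoD(2)[OF isometry]
  note \<Phi> = isometry_ontoD(2)[OF orbit_isometry_onto]
  have norm: "frobenius_norm (E * orbit_isometry x) = frobenius_norm (E * \<Psi>)" if x: "x \<in> X" for x
  proof -
    note tx = transversal(1)[OF x]
    have "E * orbit_isometry x = (E * \<rho> (t x)) * \<Psi>"
      unfolding orbit_isometry_def by (rule assoc_mult_mat[symmetric, OF E(1) E(4)[OF tx] \<Psi>])
    also have "\<dots> = \<rho>' (t x) * (E * \<Psi>)"
      unfolding E(6)[OF tx] by (rule assoc_mult_mat[OF E(5)[OF tx] E(1) \<Psi>])
    finally show ?thesis
      using frobenius_norm_unitary_mult[OF unitary_rep_carrier[OF \<rho>' tx]
          mult_carrier_mat[OF E(1) \<Psi>]]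
      by simp
  qed
  have "E * frame_op * mat_adjoint E = fusion_frame_op m X (\<lambda>x. E * orbit_isometry x)"
    by (rule mult_fusion_frame_op_mult_adjoint[OF E(1) \<Phi>])
  then have "mat_trace (E * frame_op * mat_adjoint E) =
      of_real (\<Sum>x\<in>X. (frobenius_norm (E * orbit_isometry x))\<^sup>2)"
    using mat_trace_fusion_frame_op[OF mult_carrier_mat[OF E(1) \<Phi>]] by simp
  then show ?thesis by (simp add: norm)
qed

lemma tight_fusion_frame_direct_sum:
  fixes \<rho>i :: "nat \<Rightarrow> 'g \<Rightarrow> 'a mat"
  assumes "finite X"
    and direct_sum: "d = block_offset n l" "\<rho> = direct_sum_rep l \<rho>i"
    and \<rho>i: "\<And>i. i < l \<Longrightarrow> \<rho>i i \<in> hom G (unitary_group (n i))"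
    and irr: "\<And>i. i < l \<Longrightarrow> irreducible_rep G (n i) (\<rho>i i)"
    and inequiv: "\<And>i j. i < l \<Longrightarrow> j < l \<Longrightarrow> i \<noteq> j \<Longrightarrow>
      \<not> equivalent_reps G (n i) (\<rho>i i) (n j) (\<rho>i j)"
    and block_norm: "\<And>i. i < l \<Longrightarrow> (frobenius_norm (block_proj n l i * \<Psi>))\<^sup>2 = c * real (n i)"
  shows "tight_fusion_frame d r X orbit_subspace"
proof (rule tight_fusion_frameI[OF orbit_isometry_onto])
  show "frame_op = of_real (real (card X) * c) \<cdot>\<^sub>m 1\<^sub>m d"
    unfolding direct_sum(1)
  proof (rule self_adjoint_direct_sum_intertwiner_scalar[OF \<rho>i irr inequiv])
    show "intertwiner G (block_offset n l) (direct_sum_rep l \<rho>i) (block_offset n l)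
        (direct_sum_rep l \<rho>i) (fusion_frame_op (block_offset n l) X orbit_isometry)"
      using frame_op_intertwiner by (simp only: direct_sum)
    show "mat_adjoint (fusion_frame_op (block_offset n l) X orbit_isometry) =
        fusion_frame_op (block_offset n l) X orbit_isometry"
      using mat_adjoint_fusion_frame_op[OF \<open>finite X\<close> isometry_ontoD(2)[OF orbit_isometry_onto]]
      by (simp only: direct_sum)
    fix i assume i: "i < l"
    have "intertwiner G (block_offset n l) (direct_sum_rep l \<rho>i) (n i) (\<rho>i i) (block_proj n l i)"
      using unitary_rep_carrier_mat[OF \<rho>i] i by (intro block_proj_intertwiner)
    from mat_trace_frame_op_compression[OF \<rho>i[OF i] this[folded direct_sum]]
    show "mat_trace (block_proj n l i * fusion_frame_op (block_offset n l) X orbit_isometry *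
        mat_adjoint (block_proj n l i)) = of_real (real (card X) * c) * of_nat (n i)"
      by (simp add: block_norm[OF i] direct_sum(1))
  qed
qed

lemma equi_chordal_orbit:
  assumes "doubly_homogeneous G X \<sigma>"
  shows "equi_chordal d r X orbit_subspace"
  using assms action_automorphisms orbit_isometry_onto by (rule doubly_homogeneous_equi_chordal)

lemma equi_isoclinic_orbit_iff:
  assumes dh: "doubly_homogeneous G X \<sigma>" and two: "card X \<ge> 2"
  shows "equi_isoclinic d r X orbit_subspace \<longleftrightarrow>
    (\<exists>g \<in> carrier G - stabilizer G \<sigma> x0. isoclinic d r W ((*\<^sub>v) (\<rho> g) ` W))"
proof
  assume equi: "equi_isoclinic d r X orbit_subspace"
  have "\<not> X \<subseteq> {x0}"
    using two card_mono[of "{x0}" X] by auto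
  then obtain x where x: "x \<in> X" "x \<noteq> x0" by blast
  then have "isoclinic d r (orbit_subspace x0) (orbit_subspace x)"
    using equi base_point unfolding equi_isoclinic_def isoclinic_def by metis
  then have "isoclinic d r W ((*\<^sub>v) (\<rho> (t x)) ` W)"
    by (simp only: orbit_subspace_base orbit_subspace_def[of x])
  moreover have "t x \<in> carrier G - stabilizer G \<sigma> x0"
    using transversal x by (simp add: stabilizer_def)
  ultimately show "\<exists>g \<in> carrier G - stabilizer G \<sigma> x0. isoclinic d r W ((*\<^sub>v) (\<rho> g) ` W)"
    by blast
next
  assume "\<exists>g \<in> carrier G - stabilizer G \<sigma> x0. isoclinic d r W ((*\<^sub>v) (\<rho> g) ` W)"
  then obtain g where g: "g \<in> carrier G" "\<sigma> g x0 \<noteq> x0" and "isoclinic d r W ((*\<^sub>v) (\<rho> g) ` W)"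
    by (auto simp: stabilizer_def)
  then have "isoclinic d r (orbit_subspace x0) (orbit_subspace (\<sigma> g x0))"
    by (simp add: orbit_subspace_base rep_image_base)
  then show "equi_isoclinic d r X orbit_subspace"
    using g element_image[OF g(1) base_point refl] base_point
    by (intro doubly_homogeneous_equi_isoclinic[OF dh action_automorphisms, of x0 "\<sigma> g x0"]) auto
qed

end

theorem theorem3p9:
  fixes G :: "('g, 'b) monoid_scheme"
    and X :: "'x set"
    and \<sigma> :: "'g \<Rightarrow> 'x \<Rightarrow> 'x"
    and x0 :: 'x
    and H :: "'g set"
    and t :: "'x \<Rightarrow> 'g"
    and l r d :: nat
    and n :: "nat \<Rightarrow> nat"
    and \<rho>i :: "nat \<Rightarrow> 'g \<Rightarrow> 'a::real_or_complex mat"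
    and \<pi> :: "'g \<Rightarrow> 'a mat"
    and \<Psi>i :: "nat \<Rightarrow> 'a mat"
    and \<rho> :: "'g \<Rightarrow> 'a mat"
    and \<Psi> :: "'a mat"
    and W :: "'a vec set"
    and \<W> :: "'x \<Rightarrow> 'a vec set"
  assumes "finite (carrier G)" and "finite X"
    and "transitive_action G X \<sigma>"
    and "x0 \<in> X" and H: "H = stabilizer G \<sigma> x0"
    and "\<And>x. x \<in> X \<Longrightarrow> t x \<in> carrier G \<and> \<sigma> (t x) x0 = x"
    and "l \<ge> 1"
    and "\<And>i. i < l \<Longrightarrow> \<rho>i i \<in> hom G (unitary_group (n i)) \<and> irreducible_rep G (n i) (\<rho>i i)"
    and "\<And>i j. i < l \<Longrightarrow> j < l \<Longrightarrow> i \<noteq> j \<Longrightarrow> \<not> equivalent_reps G (n i) (\<rho>i i) (n j) (\<rho>i j)"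
    and "\<pi> \<in> hom (G\<lparr>carrier := H\<rparr>) (unitary_group r)"
    and "\<And>i. i < l \<Longrightarrow> is_isometry (n i) r (\<Psi>i i)"
    and "\<And>i h. i < l \<Longrightarrow> h \<in> H \<Longrightarrow> \<rho>i i h * \<Psi>i i = \<Psi>i i * \<pi> h"
    and d: "d = (\<Sum>i<l. n i)"
    and \<rho>: "\<rho> = (\<lambda>g. diag_block_mat (map (\<lambda>i. \<rho>i i g) [0..<l]))"
    and \<Psi>: "\<Psi> = stack_rows r (map (\<lambda>i. of_real (sqrt (real (n i) / real d)) \<cdot>\<^sub>m \<Psi>i i) [0..<l])"
    and W: "W = mat_image \<Psi>"
    and \<W>: "\<W> = (\<lambda>x. (\<lambda>v. \<rho> (t x) *\<^sub>v v) ` W)"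
  shows "isometry_onto d r \<Psi> W \<and> is_subspace d W
    \<and> tight_fusion_frame d r X \<W>
    \<and> \<sigma> ` carrier G \<subseteq> ensemble_automorphisms d X \<W>
    \<and> (doubly_homogeneous G X \<sigma> \<longrightarrow>
         equi_chordal_tff d r X \<W>
         \<and> (card X \<ge> 2 \<longrightarrow>
              (equi_isoclinic_tff d r X \<W> \<longleftrightarrow>
                (\<exists>g \<in> carrier G - H. isoclinic d r W ((\<lambda>v. \<rho> g *\<^sub>v v) ` W)))))"
proof -
  note finite_X = assms(2) and action = assms(3) and base_point = assms(4)
    and transversal = assms(6) and l_pos = assms(7) and inequiv = assms(9)
    and \<rho>i = assms(8)[THEN conjunct1] and irr = assms(8)[THEN conjunct2]
    and \<pi> = assms(10) and isometries = assms(11) and intertwining = assms(12)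
  note stack = dimension_weighted_stack[of l n r \<Psi>i,
      OF isometries l_pos irreducible_rep_dim_pos[OF irr], folded d, folded \<Psi>]
  have onto: "isometry_onto d r \<Psi> W"
    using stack(1) by (simp add: isometry_onto_def W)
  have "intertwiner (G\<lparr>carrier := H\<rparr>) r \<pi> (n i) (\<rho>i i) (\<Psi>i i)" if "i < l" for i
    using that is_isometryD(1)[OF isometries] unitary_rep_carrier_mat[OF \<rho>i]
      unitary_rep_carrier_mat[OF \<pi>] intertwining
    by (intro intertwinerI) (auto simp: H stabilizer_def)
  from weighted_stack_image_invariant[OF \<pi> this]
  have invariant: "(*\<^sub>v) (\<rho> h) ` W = W" if "h \<in> stabilizer G \<sigma> x0" for h
    using that by (simp add: \<rho> W \<Psi> H)
  have rep: "\<rho> \<in> hom G (unitary_group d)"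
    unfolding \<rho> d by (rule direct_sum_rep_unitary[OF \<rho>i])
  interpret orbit_ensemble G X \<sigma> x0 t d r \<rho> \<Psi> W
    using transitive_action.axioms(1)[OF action] base_point transversal rep onto invariant
    by (simp add: orbit_ensemble_def orbit_ensemble_axioms_def)
  have "tight_fusion_frame d r X orbit_subspace"
    by (rule tight_fusion_frame_direct_sum[OF finite_X d \<rho> \<rho>i irr inequiv stack(2)])
  moreover have "\<W> = orbit_subspace"
    by (simp add: \<W> orbit_subspace_def fun_eq_iff)
  ultimately show ?thesis
    unfolding equi_chordal_tff_def equi_isoclinic_tff_def H
    using onto isometry_onto_subspace(1)[OF onto] action_automorphisms equi_chordal_orbit
      equi_isoclinic_orbit_iff by blast
qed

end
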